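(* Let $\gamma,\beta$ be irrational real numbers such that the pair $(\gamma,\beta)$ is Diophantine. Then there is $\omega_0>0$, depending only on $\gamma$ and $\beta$, such that the following holds for every $\omega\in(0,\omega_0)$. Let $\gamma'$ be a real number and let $\psi:\mathbb{N}\to\mathbb{R}^+$ be a function with $$\psi(q)=O\left(\frac{1}{q\log q\,(\log\log q)^2}\right).$$ If $$\sum_{\substack{q\in\mathbb{N}\\ \|q\beta-\gamma'\|\in[q^{-\omega},1)}}\frac{\psi(q)}{\|q\beta-\gamma'\|}=\infty,$$ then $|W(\psi,\beta,\gamma,\gamma')|=1$.
   Context: $\mathbb{N}=\{1,2,3,\dots\}$ and $\mathbb{R}^+=(0,\infty)$. For real $x$, $\|x\|$ is the distance from $x$ to the nearest integer. $|A|$ denotes the Lebesgue measure of a measurable set $A\subset\mathbb{R}$. $\log$ is the base $2$ logarithm. The bound $f(q)=O(g(q))$ means that there is a constant $C>0$ with $f(q)\le Cg(q)$ for all $q$ for which $g(q)$ is defined and positive (here $q\ge 3$). For $\psi:\mathbb{N}\to\mathbb{R}^+$ and real numbers $\beta,\gamma,\gamma'$, $$W(\psi,\beta,\gamma,\gamma')=\{x\in[0,1]:\ \|qx-\gamma\|\,\|q\beta-\gamma'\|<\psi(q)\text{ for infinitely many } q\in\mathbb{N}\}.$$ A pair $(\gamma_1,\gamma_2)$ of $\mathbb{Q}$-linearly independent real numbers is called Diophantine if there are $\rho,c>0$ such that $\|n_1\gamma_1+n_2\gamma_2\|\ge c\,(\max\{|n_1|,|n_2|\})^{-\rho}$ for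 all $(n_1,n_2)\in\mathbb{Z}^2\setminus\{(0,0)\}$. *)

theory Defs
  imports "HOL-Analysis.Analysis"
begin

definition int_dist :: "real \<Rightarrow> real" where
  "int_dist x = \<bar>x - of_int (round x)\<bar>"

(* The positive integers q index everything; type nat contains 0, which is excluded by q \<ge> 1. *)
definition W :: "(nat \<Rightarrow> real) \<Rightarrow> real \<Rightarrow> real \<Rightarrow> real \<Rightarrow> real set" where
  "W \<psi> \<beta> \<gamma> \<gamma>' =
     {x \<in> {0..1}. infinite {q::nat. q \<ge> 1 \<and>
        int_dist (of_nat q * x - \<gamma>) * int_dist (of_nat q * \<beta> - \<gamma>') < \<psi> q}}"

definition rat_lin_indep :: "real \<Rightarrow> real \<Rightarrow> bool" where
  "rat_lin_indep x y \<longleftrightarrow>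
     (\<forall>a b :: rat. of_rat a * x + of_rat b * y = 0 \<longrightarrow> a = 0 \<and> b = 0)"

definition diophantine_pair :: "real \<Rightarrow> real \<Rightarrow> bool" where
  "diophantine_pair \<gamma>\<^sub>1 \<gamma>\<^sub>2 \<longleftrightarrow>
     rat_lin_indep \<gamma>\<^sub>1 \<gamma>\<^sub>2 \<and>
     (\<exists>\<rho> c :: real. \<rho> > 0 \<and> c > 0 \<and>
        (\<forall>n\<^sub>1 n\<^sub>2 :: int. (n\<^sub>1, n\<^sub>2) \<noteq> (0, 0) \<longrightarrow>
           int_dist (of_int n\<^sub>1 * \<gamma>\<^sub>1 + of_int n\<^sub>2 * \<gamma>\<^sub>2)
             \<ge> c * of_int (max \<bar>n\<^sub>1\<bar> \<bar>n\<^sub>2\<bar>) powr (- \<rho>)))"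

end

theory Submission
  imports Defs "HOL-Computational_Algebra.Primes" "HOL-Probability.Probability_Measure" "HOL-Real_Asymp.Real_Asymp"
begin

text \<open>
  Put \<open>\<delta>(q) = \<psi>(q) / \<parallel>q\<beta> - \<gamma>'\<parallel>\<close> and \<open>A\<^sub>q = {x. \<parallel>qx - \<gamma>\<parallel> < \<delta>(q)}\<close>, for those \<open>q\<close> in the
  range of summation with \<open>\<delta>(q) \<ge> 1 / (q ln\<^sup>2 q)\<close>; the other \<open>q\<close> contribute a convergent sum. With
  \<open>g = gcd(u, v)\<close> and \<open>\<delta>(u)/u \<le> \<delta>(v)/v\<close>, counting arcs gives
  \<open>|A\<^sub>u \<inter> A\<^sub>v| \<le> 4 \<delta>(u) \<delta>(v) + 2 g \<delta>(u)/u\<close>, where the last term is only present if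
  \<open>\<parallel>(v - u)\<gamma>/g\<parallel> < 2u \<delta>(v)/g\<close>. If for every \<open>u\<close> the sum of \<open>g\<close> over all such \<open>v\<close> is \<open>O(u)\<close>, then
  the number of sets \<open>A\<^sub>q\<close> containing a random point has variance at most a constant times its mean, and
  since the mean diverges, almost every point lies in infinitely many \<open>A\<^sub>q\<close>.

  Fixing the index \<open>u\<close> with the smaller ratio is what makes this sum small. For \<open>g\<close> larger than a small
  power of \<open>u\<close>, already the condition on \<open>\<gamma>\<close> saves a power of \<open>u\<close>. For smaller \<open>g\<close> the sizes of
  \<open>v/u\<close> and of \<open>\<parallel>v\<beta> - \<gamma>'\<parallel>\<close> are split dyadically, and the Diophantine condition on \<open>(\<gamma>, \<beta>)\<close> shows by
  a large sieve argument that the two conditions on \<open>\<gamma>\<close> and \<open>\<beta>\<close> are independent up to a constant.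
  With \<open>Y = ln u\<close> the resulting bound is \<open>u (ln Y)\<^sup>2 / Y\<close> times the sum of \<open>g powr (\<theta> - 1)\<close> over \<open>g | u\<close>, where
  \<open>\<theta> = 1 / (5 ln Y)\<close>, and this sum is \<open>O(Y powr (5/8))\<close>.
\<close>

section \<open>Counting in Bohr sets\<close>

lemma int_dist_nonneg [simp]: "0 \<le> int_dist x"
  by (simp add: int_dist_def)

lemma int_dist_le_half: "int_dist x \<le> 1/2"
  unfolding int_dist_def using of_int_round_abs_le[of x] by (simp add: abs_minus_commute)

lemma int_dist_le: "int_dist x \<le> \<bar>x - of_int n\<bar>"
  unfolding int_dist_def by (rule round_diff_minimal)

lemma int_dist_obtain:
  obtains n :: int where "int_dist x = \<bar>x - of_int n\<bar>"
  unfolding int_dist_def by blast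

lemma int_dist_add_of_int [simp]: "int_dist (x + of_int n) = int_dist x"
proof (rule antisym)
  obtain m where "int_dist x = \<bar>x - of_int m\<bar>" by (rule int_dist_obtain)
  with int_dist_le[of "x + of_int n" "m + n"] show "int_dist (x + of_int n) \<le> int_dist x" by simp
  obtain m where "int_dist (x + of_int n) = \<bar>x + of_int n - of_int m\<bar>" by (rule int_dist_obtain)
  with int_dist_le[of "x" "m - n"] show "int_dist x \<le> int_dist (x + of_int n)" by simp
qed

lemma int_dist_triangle: "int_dist (x + y) \<le> int_dist x + int_dist y"
proof -
  obtain m where m: "int_dist x = \<bar>x - of_int m\<bar>" by (rule int_dist_obtain)
  obtain n where n: "int_dist y = \<bar>y - of_int n\<bar>" by (rule int_dist_obtain)
  show ?thesis unfolding m n using int_dist_le[of "x + y" "m + n"] by simp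
qed

section \<open>Exponential sums\<close>

text \<open>The Taylor remainder \<open>\<bar>y\<bar> ^ 3 / 6\<close> is at most half of
  \<open>\<bar>y\<bar>\<close> because (pi/2)^2 < 3.\<close>

lemma abs_sin_ge_half:
  fixes y :: real
  assumes "\<bar>y\<bar> \<le> pi / 2"
  shows "\<bar>y\<bar> / 2 \<le> \<bar>sin y\<bar>"
proof -
  have "\<bar>sin y - (\<Sum>m<3. sin_coeff m * y ^ m)\<bar> \<le> inverse (fact 3) * \<bar>y\<bar> ^ 3"
    by (rule Maclaurin_sin_bound)
  then have "\<bar>sin y - y\<bar> \<le> \<bar>y\<bar> ^ 3 / 6"
    by (simp add: numeral_3_eq_3 sin_coeff_def fact_numeral)
  moreover have "\<bar>y\<bar> ^ 3 / 6 \<le> \<bar>y\<bar> / 2"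
  proof -
    have "\<bar>y\<bar> \<le> 17/10" using assms pi_approx by simp
    then have "\<bar>y\<bar> ^ 2 \<le> (17/10) ^ 2" by (intro power_mono) auto
    then have "\<bar>y\<bar> * \<bar>y\<bar> ^ 2 \<le> \<bar>y\<bar> * 3" by (intro mult_left_mono) (auto simp: power2_eq_square)
    then show ?thesis by (simp add: power3_eq_cube power2_eq_square)
  qed
  ultimately show ?thesis by linarith
qed

text \<open>The chord from 1 to \<open>cis (2 * pi * \<theta>)\<close> has length 2 |sin y|, where
  |y| is pi times \<open>int_dist \<theta>\<close>. The sine bound makes this at least |y|, and pi >
  2.\<close>

lemma norm_cis_minus_one_ge: "int_dist \<theta> \<le> norm (cis (2 * pi * \<theta>) - 1) / 2"
proof -
  obtain n where n: "int_dist \<theta> = \<bar>\<theta> - of_int n\<bar>" by (rule int_dist_obtain)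
  define y where "y = pi * (\<theta> - of_int n)"
  have y: "\<bar>y\<bar> = pi * int_dist \<theta>" by (simp add: y_def n abs_mult)
  have "cis (2 * pi * \<theta>) = cis (2 * y) * cis (2 * pi * of_int n)"
    by (simp add: cis_mult y_def algebra_simps)
  also have "\<dots> = cis (2 * y)" by simp
  finally have "norm (cis (2 * pi * \<theta>) - 1) = 2 * \<bar>sin y\<bar>"
    using dist_exp_i_1[of "2 * y"] by (simp add: cis_conv_exp)
  moreover have "\<bar>y\<bar> / 2 \<le> \<bar>sin y\<bar>"
    using int_dist_le_half[of \<theta>] by (intro abs_sin_ge_half) (simp add: y)
  moreover have "2 * int_dist \<theta> \<le> \<bar>y\<bar>"
    unfolding y using pi_approx by (intro mult_right_mono) auto
  ultimately show ?thesis by linarith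
qed

text \<open>The geometric series formula gives the bound 2 / norm (z - 1), whatever the start and
  the length of the range.\<close>

lemma norm_sum_cis_le:
  assumes "0 < int_dist \<theta>"
  shows "norm (\<Sum>n\<in>{m..<m+N}. cis (2 * pi * (real n * \<theta>))) \<le> 1 / int_dist \<theta>"
proof -
  define z where "z = cis (2 * pi * \<theta>)"
  have z: "cis (2 * pi * (real n * \<theta>)) = z ^ n" for n
    by (simp add: z_def Complex.DeMoivre mult_ac)
  have ne: "z \<noteq> 1" using norm_cis_minus_one_ge[of \<theta>] assms by (auto simp: z_def)
  have "(\<Sum>n\<in>{m..<m+N}. z ^ n) = z ^ m * (\<Sum>n<N. z ^ n)"
    by (simp add: sum_distrib_left power_add[symmetric] sum.atLeastLessThan_shift_0 atLeast0LessThan add.commute)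
  also have "norm \<dots> = norm (\<Sum>n<N. z ^ n)" by (simp add: norm_mult norm_power z_def)
  also have "(\<Sum>n<N. z ^ n) = (z ^ N - 1) / (z - 1)" using ne by (rule geometric_sum)
  also have "norm \<dots> \<le> 2 / norm (z - 1)"
  proof -
    have "norm (z ^ N - 1) \<le> 2"
      using norm_triangle_ineq4[of "z^N" 1] by (simp add: norm_power z_def)
    then show ?thesis by (simp add: norm_divide divide_right_mono)
  qed
  also have "\<dots> \<le> 1 / int_dist \<theta>"
    using norm_cis_minus_one_ge[of \<theta>, folded z_def] assms ne by (simp add: divide_simps)
  finally show ?thesis by (simp add: z)
qed

text \<open>Every counted \<open>n\<close> makes the exponential sum over \<open>P\<close> at least half as large as possible;
  opening its square leaves a diagonal term and short geometric sums.\<close>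
lemma card_le_of_large_exponential_sum:
  fixes \<theta> \<phi> :: "'p \<Rightarrow> real" and K :: real
  assumes P: "finite P" "P \<noteq> {}" and R: "R \<subseteq> {m..<m+N}"
    and cos: "\<And>n p. n \<in> R \<Longrightarrow> p \<in> P \<Longrightarrow> 1/2 \<le> cos (2 * pi * (real n * \<theta> p + \<phi> p))"
    and K: "\<And>p p'. p \<in> P \<Longrightarrow> p' \<in> P \<Longrightarrow> p \<noteq> p' \<Longrightarrow>
       norm (\<Sum>n\<in>{m..<m+N}. cis (2 * pi * (real n * (\<theta> p - \<theta> p')))) \<le> K"
    and K0: "0 \<le> K"
  shows "real (card R) \<le> 4 * (real N / real (card P) + K)"
proof -
  define c where "c = real (card P)"
  have c: "c > 0" using P by (simp add: c_def card_gt_0_iff)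
  define S where "S = (\<lambda>n. \<Sum>p\<in>P. cis (2 * pi * (real n * \<theta> p + \<phi> p)))"
  let ?I = "{m..<m+N}"
  have "real (card R) * (c / 2)\<^sup>2 = (\<Sum>n\<in>R. (c / 2)\<^sup>2)" by simp
  also have "\<dots> \<le> (\<Sum>n\<in>R. (norm (S n))\<^sup>2)"
  proof (intro sum_mono power_mono)
    fix n assume n: "n \<in> R"
    have "c / 2 = (\<Sum>p\<in>P. 1/2)" by (simp add: c_def)
    also have "\<dots> \<le> (\<Sum>p\<in>P. cos (2 * pi * (real n * \<theta> p + \<phi> p)))"
      using cos n by (intro sum_mono) auto
    also have "\<dots> = Re (S n)" by (simp add: S_def)
    also have "\<dots> \<le> norm (S n)" by (rule complex_Re_le_cmod)
    finally show "c / 2 \<le> norm (S n)" .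
  qed (use c in auto)
  \<comment> \<open>Enlarging the range only adds nonnegative terms, and over a full interval the
    inner sums over \<open>n\<close> are those bounded by \<open>K\<close>.\<close>
  also have "\<dots> \<le> (\<Sum>n\<in>?I. (norm (S n))\<^sup>2)"
    using R by (intro sum_mono2) auto
  also have "\<dots> = Re (\<Sum>n\<in>?I. S n * cnj (S n))"
    by (simp add: complex_norm_square[symmetric] del: of_real_power)
  also have "(\<Sum>n\<in>?I. S n * cnj (S n)) =
      (\<Sum>n\<in>?I. \<Sum>p\<in>P. \<Sum>p'\<in>P. cis (2 * pi * (\<phi> p - \<phi> p')) * cis (2 * pi * (real n * (\<theta> p - \<theta> p'))))"
    unfolding S_def by (simp add: sum_product cis_cnj cis_mult algebra_simps)
  also have "\<dots> = (\<Sum>p\<in>P. \<Sum>p'\<in>P. cis (2 * pi * (\<phi> p - \<phi> p')) * (\<Sum>n\<in>?I. cis (2 * pi * (real n * (\<theta> p - \<theta> p')))))"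
    by (subst sum.swap, rule sum.cong, simp, subst sum.swap, simp add: sum_distrib_left)
  also have "Re \<dots> \<le> norm \<dots>" by (rule complex_Re_le_cmod)
  also have "\<dots> \<le> (\<Sum>p\<in>P. \<Sum>p'\<in>P. (if p' = p then real N else 0) + K)"
  proof (intro sum_norm_le)
    fix p p' assume p: "p \<in> P" "p' \<in> P"
    show "norm (cis (2 * pi * (\<phi> p - \<phi> p')) * (\<Sum>n\<in>?I. cis (2 * pi * (real n * (\<theta> p - \<theta> p')))))
      \<le> (if p' = p then real N else 0) + K"
      using K[OF p] K0 by (auto simp: norm_mult)
  qed
  also have "\<dots> = c * real N + c * c * K"
    using P by (simp add: sum.distrib c_def algebra_simps)
  finally have "real (card R) * (c/2)\<^sup>2 \<le> c * real N + c * c * K" .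
  then have "real (card R) \<le> (c * real N + c * c * K) / (c/2)\<^sup>2"
    using c by (simp add: pos_le_divide_eq)
  also have "\<dots> = 4 * (real N / c + K)" using c by (simp add: field_simps power2_eq_square)
  finally show ?thesis by (simp add: c_def)
qed

section \<open>Large sieve for two simultaneous Bohr conditions\<close>

lemma cos_ge_half_of_int_dist:
  assumes "int_dist x \<le> 1/6"
  shows "1/2 \<le> cos (2 * pi * x)"
proof -
  obtain n where n: "int_dist x = \<bar>x - of_int n\<bar>" by (rule int_dist_obtain)
  have "cos (2 * pi * x) = cos (2 * pi * (x - of_int n) + 2 * pi * of_int n)"
    by (simp add: algebra_simps)
  also have "\<dots> = cos (2 * pi * \<bar>x - of_int n\<bar>)"
    by (simp add: cos_add abs_if) (metis cos_minus minus_diff_eq mult_minus_right)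
  finally have "cos (2 * pi * x) = cos (2 * pi * int_dist x)" by (simp add: n)
  moreover have "cos (pi / 3) \<le> cos (2 * pi * int_dist x)"
    using assms by (intro cos_monotone_0_pi_le) auto
  ultimately show ?thesis by (simp add: cos_60)
qed

lemma int_dist_mult_nat_le: "int_dist (real h * x) \<le> real h * int_dist x"
proof -
  obtain n where n: "int_dist x = \<bar>x - of_int n\<bar>" by (rule int_dist_obtain)
  have "int_dist (real h * x) \<le> \<bar>real h * x - of_int (int h * n)\<bar>" by (rule int_dist_le)
  also have "\<dots> = real h * int_dist x" by (simp add: n abs_mult flip: right_diff_distrib)
  finally show ?thesis .
qed

text \<open>Makes the constants of \<open>diophantine_pair\<close> explicit, because later exponents
  are chosen in terms of them, and normalises the exponent to \<open>R \<ge> 1\<close>.\<close>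

definition diophantine_with :: "real \<Rightarrow> real \<Rightarrow> real \<Rightarrow> real \<Rightarrow> bool" where
  "diophantine_with c R \<gamma> \<beta> \<longleftrightarrow> c > 0 \<and> R \<ge> 1 \<and>
     (\<forall>m n :: int. (m, n) \<noteq> (0, 0) \<longrightarrow>
        c * real_of_int (max \<bar>m\<bar> \<bar>n\<bar>) powr (- R) \<le> int_dist (of_int m * \<gamma> + of_int n * \<beta>))"

lemma diophantine_withD:
  assumes "diophantine_with c R \<gamma> \<beta>" "m \<noteq> 0 \<or> n \<noteq> 0"
    and "real_of_int \<bar>m\<bar> \<le> B" "real_of_int \<bar>n\<bar> \<le> B"
  shows "c * B powr (- R) \<le> int_dist (of_int m * \<gamma> + of_int n * \<beta>)"
proof -
  let ?M = "real_of_int (max \<bar>m\<bar> \<bar>n\<bar>)"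
  have "?M \<ge> 1" using assms(2) by auto
  have "B powr (- R) \<le> ?M powr (- R)"
    using assms \<open>?M \<ge> 1\<close> by (intro powr_mono2') (auto simp: diophantine_with_def)
  then have "c * B powr (- R) \<le> c * ?M powr (- R)"
    using assms(1) by (intro mult_left_mono) (auto simp: diophantine_with_def)
  also have "\<dots> \<le> int_dist (of_int m * \<gamma> + of_int n * \<beta>)"
    using assms(1,2) unfolding diophantine_with_def by blast
  finally show ?thesis .
qed

text \<open>The frequencies h \<gamma> + k g \<beta> with h < \<open>M\<^sub>1\<close> and k <
  \<open>M\<^sub>2\<close> all have phases within 1/6 of an integer at a counted \<open>n\<close>.
  The difference of two of them is a nonzero integer combination of \<gamma> and \<beta> with
  coefficients at most \<open>B\<close>, so the Diophantine condition bounds the geometric sums by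
  \<open>B powr R / c\<close>. The shifts \<open>a\<close>, \<open>b\<close> only change phases. As
  h is at most \<open>M\<^sub>1 - 1\<close>, the value \<open>M\<^sub>1 = 1\<close> or
  \<open>M\<^sub>2 = 1\<close> makes the corresponding condition void.\<close>

lemma card_two_dim_bohr_le:
  fixes a b \<gamma> \<beta> :: real
  assumes dio: "diophantine_with c R \<gamma> \<beta>" and M: "1 \<le> M\<^sub>1" "1 \<le> M\<^sub>2" and g: "1 \<le> g"
    and S: "S \<subseteq> {m..<m+N}"
    and S1: "\<And>n. n \<in> S \<Longrightarrow> real (M\<^sub>1 - 1) * int_dist (real n * \<gamma> + a) \<le> 1/12"
    and S2: "\<And>n. n \<in> S \<Longrightarrow> real (M\<^sub>2 - 1) * int_dist (real n * real g * \<beta> + b) \<le> 1/12"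
  shows "real (card S) \<le> 4 * (real N / (real M\<^sub>1 * real M\<^sub>2) + real (max M\<^sub>1 (g * M\<^sub>2)) powr R / c)"
proof -
  define P where "P = {..<M\<^sub>1} \<times> {..<M\<^sub>2}"
  define \<theta> where "\<theta> = (\<lambda>(h,k). real h * \<gamma> + real k * (real g * \<beta>))"
  define \<phi> where "\<phi> = (\<lambda>(h,k). real h * a + real k * b)"
  define B where "B = max M\<^sub>1 (g * M\<^sub>2)"
  have B: "B \<ge> 1" using M by (simp add: B_def)
  have c: "c > 0" using dio by (simp add: diophantine_with_def)
  have "real (card S) \<le> 4 * (real N / real (card P) + real B powr R / c)"
  proof (rule card_le_of_large_exponential_sum[where \<theta> = \<theta> and \<phi> = \<phi> and m = m])
    show "finite P" "P \<noteq> {}" using M by (auto simp: P_def lessThan_empty_iff)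
    show "S \<subseteq> {m..<m+N}" by fact
    show "0 \<le> real B powr R / c" using c by simp
  next
    fix n p assume n: "n \<in> S" and p: "p \<in> P"
    obtain h k where hk: "p = (h, k)" "h < M\<^sub>1" "k < M\<^sub>2" using p by (auto simp: P_def)
    have "real n * \<theta> p + \<phi> p = real h * (real n * \<gamma> + a) + real k * (real n * real g * \<beta> + b)"
      by (simp add: hk \<theta>_def \<phi>_def algebra_simps)
    also have "int_dist \<dots> \<le> real h * int_dist (real n * \<gamma> + a) + real k * int_dist (real n * real g * \<beta> + b)"
      by (intro order_trans[OF int_dist_triangle] add_mono int_dist_mult_nat_le)
    also have "\<dots> \<le> real (M\<^sub>1 - 1) * int_dist (real n * \<gamma> + a) + real (M\<^sub>2 - 1) * int_dist (real n * real g * \<beta> + b)"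
      using hk by (intro add_mono mult_right_mono) auto
    also have "\<dots> \<le> 1/6" using S1[OF n] S2[OF n] by simp
    finally show "1/2 \<le> cos (2 * pi * (real n * \<theta> p + \<phi> p))" by (rule cos_ge_half_of_int_dist)
  next
    fix p p' assume p: "p \<in> P" "p' \<in> P" "p \<noteq> p'"
    obtain h k where hk: "p = (h, k)" "h < M\<^sub>1" "k < M\<^sub>2" using p by (auto simp: P_def)
    obtain h' k' where hk': "p' = (h', k')" "h' < M\<^sub>1" "k' < M\<^sub>2" using p by (auto simp: P_def)
    let ?u = "int h - int h'" and ?v = "int g * (int k - int k')"
    have eq: "\<theta> p - \<theta> p' = of_int ?u * \<gamma> + of_int ?v * \<beta>"
      by (simp add: hk hk' \<theta>_def algebra_simps)
    have "\<bar>?v\<bar> = int g * \<bar>int k - int k'\<bar>" by (simp add: abs_mult)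
    also have "\<dots> \<le> int g * int M\<^sub>2" using hk hk' by (intro mult_left_mono) auto
    also have "\<dots> \<le> int B" by (simp add: B_def flip: of_nat_mult)
    finally have v: "\<bar>?v\<bar> \<le> int B" .
    have "\<bar>?u\<bar> \<le> int B" using hk hk' by (auto simp: B_def)
    then have u: "real_of_int \<bar>?u\<bar> \<le> real B" by linarith
    have v': "real_of_int \<bar>?v\<bar> \<le> real B" using v by linarith
    have "?u \<noteq> 0 \<or> ?v \<noteq> 0" using p hk hk' g by auto
    then have "c * real B powr (- R) \<le> int_dist (of_int ?u * \<gamma> + of_int ?v * \<beta>)"
      using u v' by (rule diophantine_withD[OF dio])
    then have low: "c * real B powr (- R) \<le> int_dist (\<theta> p - \<theta> p')" by (simp only: eq)
    have pos: "0 < c * real B powr (- R)" using c B by simp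
    have "norm (\<Sum>n\<in>{m..<m+N}. cis (2 * pi * (real n * (\<theta> p - \<theta> p')))) \<le> 1 / int_dist (\<theta> p - \<theta> p')"
      using low pos by (intro norm_sum_cis_le) linarith
    also have "\<dots> \<le> 1 / (c * real B powr (- R))"
      using low pos by (intro divide_left_mono) auto
    also have "\<dots> = real B powr R / c" by (simp add: powr_minus field_simps)
    finally show "norm (\<Sum>n\<in>{m..<m+N}. cis (2 * pi * (real n * (\<theta> p - \<theta> p')))) \<le> real B powr R / c" .
  qed
  then show ?thesis by (simp add: P_def B_def)
qed

section \<open>Sums over divisors\<close>

text \<open>Euler product by induction: split off the full power of one prime \<open>p\<close> from
  \<open>n\<close>. The powers of \<open>p\<close> contribute a finite geometric series, bounded by
  the infinite one.\<close>

lemma sum_divisors_le_prod_prime_factors: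
  fixes f :: "nat \<Rightarrow> real"
  assumes one: "f 1 = 1" and mult: "\<And>a b. a > 0 \<Longrightarrow> b > 0 \<Longrightarrow> f (a * b) = f a * f b"
    and nonneg: "\<And>a. 0 \<le> f a" and less: "\<And>p. prime p \<Longrightarrow> f p < 1"
  shows "n > 0 \<Longrightarrow> (\<Sum>d | d dvd n. f d) \<le> (\<Prod>p\<in>prime_factors n. 1 / (1 - f p))"
proof (induction n rule: less_induct)
  case (less n)
  show ?case
  proof (cases "n = 1")
    case True
    then show ?thesis using one by simp
  next
    case False
    then obtain p where p: "prime p" "p dvd n" using prime_factor_nat by blast
    obtain m where m: "n = p ^ multiplicity p n * m" "\<not> p dvd m"
      using less.prems p by (elim multiplicity_decompose'[rotated 2]) auto
    define k where "k = multiplicity p n"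
    have "multiplicity p n > 0" using p less.prems by (subst prime_multiplicity_gt_zero_iff) auto
    then have k: "k \<ge> 1" by (simp add: k_def)
    have n: "n = p ^ k * m" unfolding k_def by (rule m(1))
    have m0: "m > 0" using less.prems n by (cases m) auto
    have "p ^ 1 \<le> p ^ k" using k p by (intro power_increasing) (auto simp: Suc_le_eq prime_gt_0_nat)
    then have "1 < p ^ k" using prime_gt_1_nat[OF p(1)] by simp
    then have mn: "m < n" using m0 n by simp
    have pf: "prime_factors n = insert p (prime_factors m)"
      using p(1) m0 k less.prems
      by (auto simp: prime_factors_dvd n prime_dvd_mult_iff prime_dvd_power_iff primes_dvd_imp_eq)
    have pnm: "p \<notin> prime_factors m" using m by auto
    have fpow: "f (p ^ i) = f p ^ i" for i
      by (induction i) (use one mult p in \<open>auto simp: prime_gt_0_nat\<close>)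
    \<comment> \<open>As \<open>f\<close> is nonnegative, covering the divisors is enough for an
      upper bound.\<close>
    have sub: "{d. d dvd n} \<subseteq> (\<lambda>(i,d). p ^ i * d) ` ({..k} \<times> {d. d dvd m})"
    proof
      fix d assume "d \<in> {d. d dvd n}"
      then have "d dvd p ^ k * m" using n by simp
      then obtain b c where bc: "d = b * c" "b dvd p ^ k" "c dvd m"
        using division_decomp by blast
      then obtain i where "i \<le> k" "b = p ^ i" using p by (auto simp: divides_primepow_nat)
      then show "d \<in> (\<lambda>(i,d). p ^ i * d) ` ({..k} \<times> {d. d dvd m})" using bc by force
    qed
    have fin: "finite ({..k} \<times> {d. d dvd m})" using m0 by simp
    have "(\<Sum>d | d dvd n. f d) \<le> sum f ((\<lambda>(i,d). p ^ i * d) ` ({..k} \<times> {d. d dvd m}))"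
      using sub fin nonneg by (intro sum_mono2) auto
    also have "\<dots> \<le> sum (f \<circ> (\<lambda>(i,d). p ^ i * d)) ({..k} \<times> {d. d dvd m})"
      using fin nonneg by (intro sum_image_le) auto
    also have "\<dots> = (\<Sum>(i,d)\<in>{..k} \<times> {d. d dvd m}. f p ^ i * f d)"
    proof (intro sum.cong refl)
      fix x assume "x \<in> {..k} \<times> {d. d dvd m}"
      then obtain i d where x: "x = (i, d)" "d dvd m" by auto
      then have "d > 0" using m0 by (auto intro: Nat.gr0I)
      then show "(f \<circ> (\<lambda>(i,d). p ^ i * d)) x = (case x of (i,d) \<Rightarrow> f p ^ i * f d)"
        using p x by (simp add: mult prime_gt_0_nat fpow)
    qed
    also have "\<dots> = (\<Sum>i\<le>k. f p ^ i) * (\<Sum>d | d dvd m. f d)"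
      by (simp add: sum_product sum.cartesian_product)
    also have "\<dots> \<le> 1 / (1 - f p) * (\<Prod>p\<in>prime_factors m. 1 / (1 - f p))"
    proof (intro mult_mono less.IH mn m0)
      have "(\<Sum>i\<le>k. f p ^ i) = (\<Sum>i<Suc k. f p ^ i)" by (simp add: lessThan_Suc_atMost)
      also have "\<dots> = (1 - f p ^ Suc k) / (1 - f p)"
        using assms(4)[OF p(1)] by (subst sum_gp_strict) auto
      also have "\<dots> \<le> 1 / (1 - f p)"
        using assms(4)[OF p(1)] nonneg[of p] by (intro divide_right_mono) auto
      finally show "(\<Sum>i\<le>k. f p ^ i) \<le> 1 / (1 - f p)" .
      show "0 \<le> 1 / (1 - f p)" using assms(4)[OF p(1)] by simp
      show "0 \<le> (\<Sum>d | d dvd m. f d)" using nonneg by (intro sum_nonneg) auto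
    qed
    also have "\<dots> = (\<Prod>p\<in>prime_factors n. 1 / (1 - f p))"
      using pnm by (simp add: pf)
    finally show ?thesis .
  qed
qed

lemma sum_divisors_powr_le_prod:
  assumes "n > 0" and "s > 0"
  shows "(\<Sum>d | d dvd n. real d powr (- s)) \<le> (\<Prod>p\<in>prime_factors n. 1 / (1 - real p powr (- s)))"
proof (rule sum_divisors_le_prod_prime_factors)
  fix p :: nat assume "prime p"
  then have "real p > 1" using prime_gt_1_nat by force
  then have "real p powr (- s) < real p powr 0" using assms by (intro powr_less_mono) auto
  then show "real p powr (- s) < 1" using \<open>real p > 1\<close> by simp
qed (use assms in \<open>auto simp: powr_mult\<close>)

text \<open>Each divisor satisfies 1 \<le> (n/d) powr e with e = \<epsilon>/2, which leads to an
  Euler product. Its factors at large primes are at most \<open>p powr e\<close>, and these multiply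
  to at most \<open>n powr e\<close>; the boundedly many small primes only cost a constant.\<close>

lemma card_divisors_le_powr:
  fixes \<epsilon> :: real
  assumes "\<epsilon> > 0"
  obtains C where "C > 0" "\<And>n::nat. n > 0 \<Longrightarrow> real (card {d. d dvd n}) \<le> C * real n powr \<epsilon>"
proof -
  define e where "e = \<epsilon> / 2"
  have e: "e > 0" using assms by (simp add: e_def)
  \<comment> \<open>Primes from \<open>b\<close> on satisfy \<open>p powr e \<ge> 2\<close>, so
    their Euler factor is at most 2. The constant \<open>K\<close> below is the Euler factor at 2,
    the largest of all.\<close>
  define b where "b = (2::real) powr (1 / e)"
  define K where "K = 1 / (1 - 2 powr (- e))"
  have "(2::real) powr (- e) < 2 powr 0" using e by (intro powr_less_mono) auto
  then have K: "K \<ge> 1" "(2::real) powr (- e) < 1" by (simp_all add: K_def field_simps)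
  have "real (card {d. d dvd n}) \<le> K ^ nat \<lceil>b\<rceil> * real n powr \<epsilon>" if n: "n > 0" for n :: nat
  proof -
    have fac: "1 / (1 - real p powr (- e)) \<le> (if real p < b then K else 1) * real p powr e"
      if p: "p \<in> prime_factors n" for p
    proof -
      have p2: "p \<ge> 2" using p by (auto intro: prime_ge_2_nat)
      have pe: "real p powr e \<ge> 1" using p2 e by (simp add: ge_one_powr_ge_zero)
      have "real p powr (- e) \<le> 2 powr (- e)" using p2 e by (intro powr_mono2') auto
      then have "1 / (1 - real p powr (- e)) \<le> K"
        unfolding K_def using K by (intro divide_left_mono) auto
      moreover have "K * 1 \<le> K * real p powr e" using pe K by (intro mult_left_mono) auto
      moreover have "1 / (1 - real p powr (- e)) \<le> real p powr e" if "\<not> real p < b"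
      proof -
        have "b powr e \<le> real p powr e" using that e by (intro powr_mono2) (auto simp: b_def)
        then have "2 \<le> real p powr e" using e by (simp add: b_def powr_powr)
        moreover have "real p powr (- e) \<le> 1/2" using calculation p2 by (simp add: powr_minus field_simps)
        then have "1 / (1 - real p powr (- e)) \<le> 2" by (simp add: field_simps)
        ultimately show ?thesis by linarith
      qed
      ultimately show ?thesis by auto
    qed
    have "real (card {d. d dvd n}) = (\<Sum>d | d dvd n. 1)" by simp
    also have "\<dots> \<le> (\<Sum>d | d dvd n. real n powr e * real d powr (- e))"
    proof (intro sum_mono)
      fix d assume "d \<in> {d. d dvd n}"
      then have d: "d > 0" "d \<le> n" using n by (auto intro: Nat.gr0I dvd_imp_le)
      then have "real d powr e \<le> real n powr e" using e by (intro powr_mono2) auto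
      then show "1 \<le> real n powr e * real d powr (- e)" using d by (simp add: powr_minus field_simps)
    qed
    also have "\<dots> = real n powr e * (\<Sum>d | d dvd n. real d powr (- e))" by (simp add: sum_distrib_left)
    also have "\<dots> \<le> real n powr e * (\<Prod>p\<in>prime_factors n. 1 / (1 - real p powr (- e)))"
      using n e by (intro mult_left_mono sum_divisors_powr_le_prod) auto
    also have "\<dots> \<le> real n powr e * (\<Prod>p\<in>prime_factors n. (if real p < b then K else 1) * real p powr e)"
    proof (intro mult_left_mono prod_mono conjI fac)
      fix p assume "p \<in> prime_factors n"
      then have "p \<ge> 2" by (auto intro: prime_ge_2_nat)
      then have "real p powr (- e) \<le> 2 powr (- e)" using e by (intro powr_mono2') auto
      then show "0 \<le> 1 / (1 - real p powr (- e))" using K by simp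
    qed auto
    also have "\<dots> = real n powr e * ((\<Prod>p\<in>prime_factors n. if real p < b then K else 1) * (\<Prod>p\<in>prime_factors n. real p powr e))"
      by (simp add: prod.distrib)
    also have "\<dots> \<le> real n powr e * (K ^ nat \<lceil>b\<rceil> * real n powr e)"
    proof (intro mult_left_mono mult_mono)
      have "(\<Prod>p\<in>prime_factors n. if real p < b then K else 1) = K ^ card {p\<in>prime_factors n. real p < b}"
        by (simp add: prod.If_cases Int_def)
      also have "\<dots> \<le> K ^ nat \<lceil>b\<rceil>"
      proof (intro power_increasing K)
        have "{p\<in>prime_factors n. real p < b} \<subseteq> {..<nat \<lceil>b\<rceil>}" by (auto simp: less_ceiling_iff zless_nat_eq_int_zless)
        then show "card {p\<in>prime_factors n. real p < b} \<le> nat \<lceil>b\<rceil>"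
          using card_mono[of "{..<nat \<lceil>b\<rceil>}"] by fastforce
      qed
      finally show "(\<Prod>p\<in>prime_factors n. if real p < b then K else 1) \<le> K ^ nat \<lceil>b\<rceil>" .
      have dv: "\<Prod>(prime_factors n) dvd n"
      proof -
        have "\<Prod>(prime_factors n) dvd (\<Prod>p\<in>prime_factors n. p ^ multiplicity p n)"
          by (intro prod_dvd_prod) (auto simp: prime_factors_multiplicity)
        then show ?thesis using n by (simp add: prime_factorization_nat[symmetric])
      qed
      have "(\<Prod>p\<in>prime_factors n. real p powr e) = real (\<Prod>(prime_factors n)) powr e"
        by (simp add: prod_powr_distrib)
      also have "\<dots> \<le> real n powr e"
        using dv n e by (intro powr_mono2) (auto dest: dvd_imp_le simp del: of_nat_prod)
      finally show "(\<Prod>p\<in>prime_factors n. real p powr e) \<le> real n powr e" .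
    qed (use K in \<open>auto intro!: prod_nonneg\<close>)
    also have "\<dots> = K ^ nat \<lceil>b\<rceil> * real n powr \<epsilon>"
      by (simp add: e_def powr_add[symmetric])
    finally show ?thesis .
  qed
  moreover have "K ^ nat \<lceil>b\<rceil> > 0" using K by simp
  ultimately show thesis using that by blast
qed

section \<open>Divisor sums with exponent near -1\<close>

text \<open>Separates the first-order term, which governs the growth of the Euler product, from a
  quadratic error that is summable over primes.\<close>

lemma inverse_one_minus_le_exp:
  fixes x :: real
  assumes "0 \<le> x" "x \<le> 2/3"
  shows "1 / (1 - x) \<le> exp (x + 3 * x\<^sup>2)"
proof -
  have "1 \<le> 1 + x\<^sup>2 * (2 - 3 * x)" using assms by simp
  also have "\<dots> = (1 + (x + 3 * x\<^sup>2)) * (1 - x)" by (simp add: algebra_simps power2_eq_square)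
  finally have "1 / (1 - x) \<le> 1 + (x + 3 * x\<^sup>2)" using assms by (simp add: field_simps)
  also have "\<dots> \<le> exp (x + 3 * x\<^sup>2)" by (rule exp_ge_add_one_self)
  finally show ?thesis .
qed

lemma harm_le_one_plus_ln:
  assumes "n > 0"
  shows "harm n \<le> 1 + ln (real n)"
proof -
  have "harm (Suc (n - 1)) - ln (real (Suc (n - 1))) \<le> harm (Suc 0) - ln (real (Suc 0))"
    using decseq_harm_diff_ln unfolding decseq_def by blast
  then show ?thesis using assms by (simp add: harm_def)
qed

text \<open>Only the odd integers can be primes beyond 2, which is where the factor 1/2 comes from.\<close>
lemma sum_inverse_primes_le:
  fixes Y :: real
  assumes "Y \<ge> 1" "finite A" "\<And>p. p \<in> A \<Longrightarrow> prime p \<and> real p \<le> Y"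
  shows "(\<Sum>p\<in>A. 1 / real p) \<le> 1 + ln Y / 2"
proof -
  define N where "N = nat \<lfloor>Y\<rfloor>"
  have N: "N > 0" "real N \<le> Y" using assms(1) by (auto simp: N_def)
  have "A \<subseteq> insert 2 ((\<lambda>m. 2 * m + 1) ` {1..N})"
  proof
    fix p assume "p \<in> A"
    then have p: "prime p" "real p \<le> Y" using assms(3) by auto
    then have "p \<le> N" by (simp add: N_def le_nat_floor)
    show "p \<in> insert 2 ((\<lambda>m. 2 * m + 1) ` {1..N})"
    proof (cases "p = 2")
      case False
      then have "p > 2" using prime_ge_2_nat[OF p(1)] by simp
      then have "odd p" using p(1) prime_odd_nat by blast
      then obtain m where "p = 2 * m + 1" by (rule oddE)
      then show ?thesis using \<open>p > 2\<close> \<open>p \<le> N\<close> by auto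
    qed simp
  qed
  then have "(\<Sum>p\<in>A. 1 / real p) \<le> (\<Sum>p\<in>insert 2 ((\<lambda>m. 2 * m + 1) ` {1..N}). 1 / real p)"
    by (intro sum_mono2) auto
  also have "\<dots> \<le> 1/2 + (\<Sum>p\<in>(\<lambda>m. 2 * m + 1) ` {1..N}. 1 / real p)"
    by (subst sum.insert) (simp, (auto; presburger), simp)
  also have "(\<Sum>p\<in>(\<lambda>m. 2 * m + 1) ` {1..N}. 1 / real p) = (\<Sum>m\<in>{1..N}. 1 / real (2 * m + 1))"
    by (subst sum.reindex) (auto simp: inj_on_def)
  also have "\<dots> \<le> (\<Sum>m\<in>{1..N}. 1 / 2 * inverse (real m))"
    by (intro sum_mono) (auto simp: field_simps)
  also have "\<dots> = harm N / 2" unfolding sum_distrib_left[symmetric] by (simp add: harm_def)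
  also have "\<dots> \<le> (1 + ln Y) / 2"
  proof -
    have "harm N \<le> 1 + ln (real N)" using N by (intro harm_le_one_plus_ln)
    moreover have "ln (real N) \<le> ln Y" using N by simp
    ultimately have "harm N \<le> 1 + ln Y" by (rule order_trans[OF _ add_left_mono])
    then show ?thesis by (rule divide_right_mono) simp
  qed
  finally show ?thesis by (simp add: field_simps)
qed

text \<open>Serves to bound the number of distinct primes dividing \<open>n\<close> by a multiple of
  ln n.\<close>

lemma two_power_card_prime_factors_le:
  fixes n :: nat
  assumes "n > 0"
  shows "2 ^ card (prime_factors n) \<le> n"
proof -
  have "2 ^ card (prime_factors n) = (\<Prod>p\<in>prime_factors n. (2::nat))" by simp
  also have "\<dots> \<le> (\<Prod>p\<in>prime_factors n. p ^ multiplicity p n)"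
  proof (intro prod_mono conjI)
    fix p assume p: "p \<in> prime_factors n"
    then have "p ^ 1 \<le> p ^ multiplicity p n"
      by (intro power_increasing) (auto simp: prime_factors_multiplicity Suc_le_eq prime_gt_0_nat)
    moreover have "2 \<le> p" using p by (auto intro: prime_ge_2_nat)
    ultimately show "2 \<le> p ^ multiplicity p n" by simp
  qed simp
  also have "\<dots> = n" using assms by (simp add: prime_factorization_nat[symmetric])
  finally show ?thesis .
qed

text \<open>Take logarithms in the Euler product, with Y = ln n. For primes up to Y, replacing the
  exponent -s by -1 costs at most Y powr (1 - s) = exp (1/5) \<le> 5/4, so they contribute 5/4 times
  (1 + ln Y / 2); this is the origin of 5/8. At most 2 Y primes exceed Y, each contributing at most
  (5/4) / Y, and the squares sum to a constant.\<close>

lemma sum_divisors_powr_near_minus_one: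
  obtains C :: real where "C > 0" "\<And>n::nat. 3 \<le> ln (real n) \<Longrightarrow>
     (\<Sum>d | d dvd n. real d powr (1 / (5 * ln (ln (real n))) - 1)) \<le> C * ln (real n) powr (5/8)"
proof -
  define S0 where "S0 = (\<Sum>k. real k powr (- (8/5)))"
  have summ: "summable (\<lambda>k. real k powr (- (8/5)))" by (simp add: summable_real_powr_iff)
  have "(\<Sum>d | d dvd n. real d powr (1 / (5 * ln (ln (real n))) - 1)) \<le> exp (15/4 + 3 * S0) * ln (real n) powr (5/8)"
    if n3: "3 \<le> ln (real n)" for n :: nat
  proof -
    define Y where "Y = ln (real n)"
    have Y: "Y \<ge> 3" using n3 by (simp add: Y_def)
    have n: "n > 0" using n3 by (cases n) auto
    have lnY: "ln Y \<ge> 1"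
    proof -
      have "exp 1 \<le> Y" using Y exp_le by linarith
      then show ?thesis using Y by (simp add: ln_ge_iff)
    qed
    define s where "s = 1 - 1 / (5 * ln Y)"
    have s: "s \<ge> 4/5" "s < 1" using lnY by (auto simp: s_def field_simps)
    have Ys: "Y powr (1 - s) = exp (1/5)" using Y lnY by (simp add: powr_def s_def)
    have e15: "exp (1/5 :: real) \<le> 5/4"
    proof -
      have "1 - 1/5 \<le> exp (- (1/5) :: real)" using exp_ge_add_one_self[of "- (1/5) :: real"] by simp
      then show ?thesis by (simp add: exp_minus field_simps)
    qed
    define x where "x = (\<lambda>p. real p powr (- s))"
    \<comment> \<open>The range in which \<open>inverse_one_minus_le_exp\<close> applies; the worst
      case is p = 2, s = 4/5.\<close>
    have x23: "0 \<le> x p \<and> x p \<le> 2/3" if "p \<in> prime_factors n" for p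
    proof -
      have p2: "p \<ge> 2" using that by (auto intro: prime_ge_2_nat)
      have "x p \<le> 2 powr (- s)" unfolding x_def using p2 s by (intro powr_mono2') auto
      also have "\<dots> \<le> 2 powr (- (4/5))" using s by (intro powr_mono) auto
      also have "\<dots> \<le> 2/3"
      proof (rule ccontr)
        assume "\<not> 2 powr (- (4/5)) \<le> (2/3 :: real)"
        then have "(2/3 :: real) powr 5 < (2 powr (- (4/5))) powr 5" by (intro powr_less_mono2) auto
        moreover have "(2 powr (- (4/5))) powr 5 = (2::real) powr (- 4)" by (simp add: powr_powr)
        moreover have "(2::real) powr (- 4) = 1 / 16" by (simp add: powr_minus)
        moreover have "(2/3 :: real) powr 5 = 32 / 243" by (simp add: power_divide)
        ultimately show False by simp
      qed
      finally show ?thesis by (simp add: x_def)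
    qed
    let ?P = "prime_factors n"
    define A where "A = {p\<in>?P. real p \<le> Y}"
    define B where "B = {p\<in>?P. \<not> real p \<le> Y}"
    have "(\<Sum>p\<in>?P. x p) = (\<Sum>p\<in>A. x p) + (\<Sum>p\<in>B. x p)"
    proof -
      have "sum x (A \<union> B) = sum x A + sum x B"
        by (rule sum.union_disjoint) (auto simp: A_def B_def)
      moreover have "?P = A \<union> B" by (auto simp: A_def B_def)
      ultimately show ?thesis by simp
    qed
    also have "(\<Sum>p\<in>A. x p) \<le> (\<Sum>p\<in>A. 5/4 * (1 / real p))"
    proof (rule sum_mono)
      fix p assume "p \<in> A"
      then have p: "p \<ge> 2" "real p \<le> Y" by (auto simp: A_def intro: prime_ge_2_nat)
      have "x p = real p powr (1 - s) * (1 / real p)" using p by (simp add: x_def powr_diff powr_minus field_simps)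
      also have "real p powr (1 - s) \<le> Y powr (1 - s)" using p s by (intro powr_mono2) auto
      also have "\<dots> \<le> 5/4" using Ys e15 by simp
      finally show "x p \<le> 5/4 * (1 / real p)" by (simp add: divide_right_mono)
    qed
    also have "\<dots> \<le> 5/4 * (1 + ln Y / 2)"
      unfolding sum_distrib_left[symmetric]
      using Y by (intro mult_left_mono sum_inverse_primes_le) (auto simp: A_def)
    also have "(\<Sum>p\<in>B. x p) \<le> (\<Sum>p\<in>B. 5/4 / Y)"
    proof (rule sum_mono)
      fix p assume "p \<in> B"
      then have p: "Y < real p" by (auto simp: B_def)
      have "x p \<le> Y powr (- s)" unfolding x_def using p s Y by (intro powr_mono2') auto
      also have "\<dots> = exp (1/5) / Y" using Y by (simp add: Ys[symmetric] powr_diff powr_minus field_simps)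
      also have "\<dots> \<le> 5/4 / Y" using e15 Y by (intro divide_right_mono) auto
      finally show "x p \<le> 5/4 / Y" .
    qed
    also have "\<dots> = real (card B) * (5/4 / Y)" by simp
    also have "\<dots> \<le> (2 * Y) * (5/4 / Y)"
    proof (rule mult_right_mono)
      have "real (2 ^ card ?P) \<le> real n" using two_power_card_prime_factors_le[OF n] by (rule of_nat_mono)
      then have "ln (2 ^ card ?P) \<le> ln (real n)" using n by (subst ln_le_cancel_iff) auto
      then have "real (card ?P) * ln 2 \<le> Y" by (simp add: Y_def ln_realpow)
      moreover have "real (card ?P) * (1/2) \<le> real (card ?P) * ln 2"
        using ln2_ge_two_thirds by (intro mult_left_mono) auto
      moreover have "card B \<le> card ?P" by (intro card_mono) (auto simp: B_def)
      ultimately show "real (card B) \<le> 2 * Y" by linarith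
    qed (use Y in auto)
    also have "\<dots> = 5/2" using Y by simp
    finally have sum1: "(\<Sum>p\<in>?P. x p) \<le> 5/4 * (1 + ln Y / 2) + 5/2" by simp
    have sum2: "(\<Sum>p\<in>?P. (x p)\<^sup>2) \<le> S0"
    proof -
      have "(\<Sum>p\<in>?P. (x p)\<^sup>2) \<le> (\<Sum>p\<in>?P. real p powr (- (8/5)))"
      proof (rule sum_mono)
        fix p assume "p \<in> ?P"
        then have p: "p \<ge> 2" by (auto intro: prime_ge_2_nat)
        have "(x p)\<^sup>2 = real p powr (- (2 * s))" using p by (simp add: x_def power2_eq_square powr_add[symmetric])
        also have "\<dots> \<le> real p powr (- (8/5))" using p s by (intro powr_mono) auto
        finally show "(x p)\<^sup>2 \<le> real p powr (- (8/5))" .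
      qed
      also have "\<dots> \<le> S0" unfolding S0_def by (rule sum_le_suminf[OF summ]) auto
      finally show ?thesis .
    qed
    have "(\<Sum>d | d dvd n. real d powr (1 / (5 * ln (ln (real n))) - 1)) = (\<Sum>d | d dvd n. real d powr (- s))"
      by (simp add: s_def Y_def)
    also have "\<dots> \<le> (\<Prod>p\<in>?P. 1 / (1 - x p))"
      unfolding x_def using n s by (intro sum_divisors_powr_le_prod) auto
    also have "\<dots> \<le> (\<Prod>p\<in>?P. exp (x p + 3 * (x p)\<^sup>2))"
      using x23 by (intro prod_mono conjI inverse_one_minus_le_exp) force+
    also have "\<dots> = exp ((\<Sum>p\<in>?P. x p) + 3 * (\<Sum>p\<in>?P. (x p)\<^sup>2))"
      by (simp add: exp_sum[symmetric] sum.distrib sum_distrib_left)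
    also have "\<dots> \<le> exp ((5/4 * (1 + ln Y / 2) + 5/2) + 3 * S0)"
      using sum1 sum2 by simp
    also have "\<dots> = exp (15/4 + 3 * S0) * Y powr (5/8)"
      using Y by (simp add: powr_def exp_add[symmetric] field_simps)
    finally show ?thesis by (simp add: Y_def)
  qed
  then show thesis using that[of "exp (15/4 + 3 * S0)"] by simp
qed

section \<open>Overlaps of approximation sets\<close>

lemma int_dist_lipschitz: "\<bar>int_dist x - int_dist y\<bar> \<le> \<bar>x - y\<bar>"
proof -
  have "int_dist x \<le> int_dist y + int_dist (x - y)" for x y
    using int_dist_triangle[of y "x - y"] by simp
  moreover have "int_dist (x - y) \<le> \<bar>x - y\<bar>" for x y using int_dist_le[of "x - y" 0] by simp
  ultimately have "int_dist x \<le> int_dist y + \<bar>x - y\<bar>" for x y by (meson add_left_mono order_trans)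
  from this[of x y] this[of y x] show ?thesis by linarith
qed


section \<open>Measure of approximation sets\<close>

text \<open>Kept as a 1-periodic subset of the whole line and cut to a unit interval only when
  measured, so that the interval can be moved freely.\<close>

definition approx_set :: "real \<Rightarrow> real \<Rightarrow> nat \<Rightarrow> real set" where
  "approx_set \<gamma> \<delta> q = {x. int_dist (real q * x - \<gamma>) < \<delta>}"

lemma isCont_int_dist: "isCont int_dist x"
  unfolding isCont_def LIM_def
  by (metis (full_types) dist_real_def int_dist_lipschitz order_le_less_trans)

lemma open_approx_set: "open (approx_set \<gamma> \<delta> q)"
proof -
  have cont: "isCont (\<lambda>x. real q * x - \<gamma>) a" for a by (intro continuous_intros)
  have "isCont (\<lambda>x. int_dist (real q * x - \<gamma>)) a" for a
    by (rule isCont_o2[OF cont isCont_int_dist])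
  then have "continuous_on UNIV (\<lambda>x. int_dist (real q * x - \<gamma>))"
    by (simp add: continuous_at_imp_continuous_on)
  then have "open {x. int_dist (real q * x - \<gamma>) < \<delta>}"
    by (rule open_Collect_less) (rule continuous_on_const)
  then show ?thesis by (simp add: approx_set_def)
qed

lemma approx_set_periodic: "x + of_int n \<in> approx_set \<gamma> \<delta> q \<longleftrightarrow> x \<in> approx_set \<gamma> \<delta> q"
proof -
  have "real q * (x + of_int n) - \<gamma> = (real q * x - \<gamma>) + of_int (int q * n)" by (simp add: algebra_simps)
  then show ?thesis unfolding approx_set_def by (simp only: mem_Collect_eq int_dist_add_of_int)
qed

lemma emeasure_lborel_translate:
  assumes "A \<in> sets borel"
  shows "emeasure lborel ((\<lambda>x. x + c) -` A) = emeasure lborel (A :: real set)"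
proof -
  have "emeasure lborel A = emeasure (distr lborel borel (\<lambda>x. c + x)) A"
    by (subst lborel_distr_plus) (rule refl)
  also have "\<dots> = emeasure lborel ((\<lambda>x. c + x) -` A)"
    using emeasure_distr[of "\<lambda>x. c + x" lborel borel A] assms by simp
  finally show ?thesis by (simp add: add.commute)
qed

text \<open>Cut the interval at the integer \<open>m\<close> that it contains and translate the two
  pieces back by \<open>m - 1\<close> and \<open>m\<close>; they fit together to
  \<open>{0..<1}\<close>.\<close>

lemma emeasure_periodic_shift:
  fixes A :: "real set"
  assumes A: "A \<in> sets borel" and per: "\<And>x n. x + of_int n \<in> A \<longleftrightarrow> x \<in> A"
  shows "emeasure lborel (A \<inter> {t..<t+1}) = emeasure lborel (A \<inter> {0..<1})"
proof -
  define m where "m = \<lceil>t\<rceil>"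
  have m: "t \<le> of_int m" "of_int m < t + 1" unfolding m_def by linarith+
  have "A \<inter> {t..<t+1} = (A \<inter> {t..<of_int m}) \<union> (A \<inter> {of_int m..<t+1})" using m by auto
  then have "emeasure lborel (A \<inter> {t..<t+1}) = emeasure lborel (A \<inter> {t..<of_int m}) + emeasure lborel (A \<inter> {of_int m..<t+1})"
    using A by (subst plus_emeasure) auto
  also have "emeasure lborel (A \<inter> {t..<of_int m}) = emeasure lborel ((\<lambda>x. x + of_int (m-1)) -` (A \<inter> {t..<of_int m}))"
    using A by (intro emeasure_lborel_translate[symmetric]) auto
  also have "(\<lambda>x. x + of_int (m-1)) -` (A \<inter> {t..<of_int m}) = A \<inter> {t - of_int (m - 1)..<1}"
  proof (rule set_eqI)
    fix x
    show "x \<in> (\<lambda>x. x + of_int (m-1)) -` (A \<inter> {t..<of_int m}) \<longleftrightarrow> x \<in> A \<inter> {t - of_int (m - 1)..<1}"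
      using per[of x "m - 1"] by auto
  qed
  also have "emeasure lborel (A \<inter> {of_int m..<t+1}) = emeasure lborel ((\<lambda>x. x + of_int m) -` (A \<inter> {of_int m..<t+1}))"
    using A by (intro emeasure_lborel_translate[symmetric]) auto
  also have "(\<lambda>x. x + of_int m) -` (A \<inter> {of_int m..<t+1}) = A \<inter> {0..<t - of_int (m - 1)}"
  proof (rule set_eqI)
    fix x
    show "x \<in> (\<lambda>x. x + of_int m) -` (A \<inter> {of_int m..<t+1}) \<longleftrightarrow> x \<in> A \<inter> {0..<t - of_int (m - 1)}"
      using per[of x m] by auto
  qed
  also have "emeasure lborel (A \<inter> {t - of_int (m - 1)..<1}) + emeasure lborel (A \<inter> {0..<t - of_int (m - 1)})
     = emeasure lborel ((A \<inter> {t - of_int (m - 1)..<1}) \<union> (A \<inter> {0..<t - of_int (m - 1)}))"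
    using A by (intro plus_emeasure) auto
  also have "(A \<inter> {t - of_int (m - 1)..<1}) \<union> (A \<inter> {0..<t - of_int (m - 1)}) = A \<inter> {0..<1}"
    using m by auto
  finally show ?thesis .
qed

text \<open>The set is cut into the \<open>q\<close> arcs around the points \<open>(\<gamma> + a) / q\<close>.\<close>
lemma emeasure_approx_set_Int:
  fixes A :: "real set"
  assumes q: "q > 0" and d: "\<delta> \<le> 1/2" and A: "A \<in> sets borel"
    and per: "\<And>x n. x + of_int n \<in> A \<longleftrightarrow> x \<in> A"
  shows "emeasure lborel (approx_set \<gamma> \<delta> q \<inter> A \<inter> {0..<1}) =
     (\<integral>\<^sup>+s\<in>{-(\<delta> / q)<..<\<delta> / q}. of_nat (card {a\<in>{..<q}. (\<gamma> + real a) / q + s \<in> A}) \<partial>lborel)"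
proof -
  \<comment> \<open>With this starting point and \<delta> \<le> 1/2, the arcs with a = 0, ..., q - 1
    lie in one period and none is cut at its ends.\<close>
  define t where "t = (\<gamma> - 1/2) / real q"
  define p where "p = (\<lambda>a::nat. (\<gamma> + real a) / real q)"
  define r where "r = \<delta> / real q"
  have qr: "real q > 0" using q by simp
  let ?B = "\<lambda>a. A \<inter> {p a - r<..<p a + r}"
  have eq: "approx_set \<gamma> \<delta> q \<inter> A \<inter> {t..<t+1} = (\<Union>a<q. ?B a)" (is "?L = ?R")
  proof (intro equalityI subsetI)
    fix x assume x: "x \<in> ?L"
    define y where "y = real q * x - \<gamma>"
    obtain n where n: "int_dist y = \<bar>y - of_int n\<bar>" by (rule int_dist_obtain)
    have yd: "\<bar>y - of_int n\<bar> < \<delta>" using x n by (simp add: approx_set_def y_def)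
    have "- 1/2 \<le> y" "y < real q - 1/2" using x qr by (auto simp: t_def y_def field_simps)
    then have "of_int n > (-1 :: real)" "of_int n < real q" using yd d by linarith+
    then have nn: "0 \<le> n" "n < int q" by linarith+
    have "x \<in> ?B (nat n)"
    proof -
      have "x - p (nat n) = (y - of_int n) / real q" using nn qr by (simp add: p_def y_def field_simps)
      then have "\<bar>x - p (nat n)\<bar> = \<bar>y - of_int n\<bar> / real q" by (simp add: abs_divide)
      also have "\<dots> < r" unfolding r_def using yd qr by (intro divide_strict_right_mono)
      finally have "\<bar>x - p (nat n)\<bar> < r" .
      then show ?thesis using x by (auto simp: abs_less_iff)
    qed
    then show "x \<in> ?R" using nn by (intro UN_I[of "nat n"]) auto
  next
    fix x assume "x \<in> ?R"
    then obtain a where a: "a < q" "x \<in> A" "\<bar>x - p a\<bar> < r" by (auto simp: abs_less_iff)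
    have "real q * x - \<gamma> - real a = real q * (x - p a)" using qr by (simp add: p_def field_simps)
    then have "\<bar>real q * x - \<gamma> - real a\<bar> = real q * \<bar>x - p a\<bar>" by (simp add: abs_mult)
    also have "\<dots> < real q * r" using a qr by (intro mult_strict_left_mono) auto
    also have "\<dots> = \<delta>" using qr by (simp add: r_def)
    finally have y: "\<bar>real q * x - \<gamma> - real a\<bar> < \<delta>" .
    then have "x \<in> approx_set \<gamma> \<delta> q"
      using int_dist_le[of "real q * x - \<gamma>" "int a"] by (auto simp: approx_set_def)
    moreover have "t \<le> x \<and> x < t + 1"
    proof -
      have "real a \<le> real q - 1" using a by linarith
      then have "\<gamma> - 1/2 \<le> real q * x" "real q * x < \<gamma> - 1/2 + real q" using y d by linarith+
      then show ?thesis using qr by (simp add: t_def field_simps)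
    qed
    ultimately show "x \<in> ?L" using a by auto
  qed
  have disj: "disjoint_family_on ?B {..<q}"
  proof (unfold disjoint_family_on_def, intro ballI impI)
    fix a b :: nat assume ab: "a \<noteq> b"
    have "\<bar>p a - p b\<bar> = \<bar>real a - real b\<bar> / real q" using qr by (simp add: p_def diff_divide_distrib[symmetric])
    moreover have "1 \<le> \<bar>real a - real b\<bar>" using ab by linarith
    ultimately have "1 / real q \<le> \<bar>p a - p b\<bar>" using qr by (simp add: divide_right_mono)
    moreover have "2 * r \<le> 1 / real q" using d qr by (simp add: r_def field_simps)
    ultimately show "?B a \<inter> ?B b = {}" by (auto simp: abs_if split: if_splits)
  qed
  have meas: "(\<lambda>s. indicator A (p a + s) :: ennreal) \<in> borel_measurable lborel" for a
  proof -
    have "(\<lambda>s. p a + s) -` A \<in> sets borel"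
      using measurable_sets[of "\<lambda>s. p a + s" borel borel A] A by simp
    moreover have "(\<lambda>s. indicator A (p a + s)) = (indicator ((\<lambda>s. p a + s) -` A) :: real \<Rightarrow> ennreal)"
      by (auto simp: indicator_def)
    ultimately show ?thesis by simp
  qed
  have "emeasure lborel (approx_set \<gamma> \<delta> q \<inter> A \<inter> {0..<1}) = emeasure lborel (approx_set \<gamma> \<delta> q \<inter> A \<inter> {t..<t+1})"
    using A open_approx_set[of \<gamma> \<delta> q] per approx_set_periodic
    by (intro emeasure_periodic_shift[symmetric]) auto
  also have "\<dots> = (\<Sum>a<q. emeasure lborel (?B a))"
    unfolding eq using A disj by (intro sum_emeasure[symmetric]) auto
  also have "\<dots> = (\<Sum>a<q. \<integral>\<^sup>+s\<in>{-r<..<r}. indicator A (p a + s) \<partial>lborel)"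
  proof (intro sum.cong refl)
    fix a
    have "emeasure lborel (?B a) = emeasure lborel ((\<lambda>x. x + p a) -` ?B a)"
      using A by (intro emeasure_lborel_translate[symmetric]) auto
    also have "\<dots> = (\<integral>\<^sup>+s. indicator ((\<lambda>x. x + p a) -` ?B a) s \<partial>lborel)"
      using measurable_sets[of "\<lambda>x. x + p a" borel borel "?B a"] A by simp
    also have "\<dots> = (\<integral>\<^sup>+s\<in>{-r<..<r}. indicator A (p a + s) \<partial>lborel)"
      by (intro nn_integral_cong) (auto simp: indicator_def add.commute)
    finally show "emeasure lborel (?B a) = (\<integral>\<^sup>+s\<in>{-r<..<r}. indicator A (p a + s) \<partial>lborel)" .
  qed
  \<comment> \<open>All arcs are superposed at a common offset \<open>s\<close> from their centres,
    so the measure becomes an integral of a count.\<close>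
  also have "\<dots> = (\<integral>\<^sup>+s. (\<Sum>a<q. indicator A (p a + s) * indicator {-r<..<r} s) \<partial>lborel)"
    by (intro nn_integral_sum[symmetric] borel_measurable_times_ennreal meas) auto
  also have "\<dots> = (\<integral>\<^sup>+s\<in>{-r<..<r}. of_nat (card {a\<in>{..<q}. p a + s \<in> A}) \<partial>lborel)"
  proof (intro nn_integral_cong)
    fix s
    have "(\<Sum>a<q. indicator A (p a + s) :: ennreal) = of_nat (card {a\<in>{..<q}. p a + s \<in> A})"
      by (simp add: indicator_def sum.If_cases Int_def)
    then show "(\<Sum>a<q. indicator A (p a + s) * indicator {-r<..<r} s) =
       of_nat (card {a\<in>{..<q}. p a + s \<in> A}) * (indicator {-r<..<r} s :: ennreal)"
      by (simp add: sum_distrib_right[symmetric])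
  qed
  finally show ?thesis by (simp add: p_def r_def)
qed

section \<open>Pairwise overlaps\<close>

lemma card_int_near_le:
  fixes z l :: real
  assumes "l > 0"
  shows "finite {b::int. \<bar>of_int b + z\<bar> < l}" "real (card {b::int. \<bar>of_int b + z\<bar> < l}) \<le> 2 * l + 1"
proof -
  have sub: "{b::int. \<bar>of_int b + z\<bar> < l} \<subseteq> {\<lfloor>- z - l\<rfloor> + 1..\<lceil>- z + l\<rceil> - 1}"
    by (auto simp: abs_less_iff) linarith+
  then show "finite {b::int. \<bar>of_int b + z\<bar> < l}" by (rule finite_subset) simp
  have "card {b::int. \<bar>of_int b + z\<bar> < l} \<le> card {\<lfloor>- z - l\<rfloor> + 1..\<lceil>- z + l\<rceil> - 1}"
    using sub by (intro card_mono) auto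
  also have "real \<dots> \<le> 2 * l + 1" using assms by simp linarith
  finally show "real (card {b::int. \<bar>of_int b + z\<bar> < l}) \<le> 2 * l + 1" by simp
qed

text \<open>An arc \<open>a\<close> is determined by \<open>a div u'\<close> and an integer \<open>b\<close> congruent to \<open>v' a\<close> modulo \<open>u'\<close>, which is
  confined to an interval of length \<open>2 u' \<delta>\<^sub>v\<close>; here \<open>u' = u / g\<close> and \<open>v' = v / g\<close>.\<close>
lemma card_arcs_in_approx_set_le:
  fixes \<gamma> s \<delta>\<^sub>u \<delta>\<^sub>v :: real and u v :: nat
  assumes u: "u > 0" and v: "v > 0" and dv: "\<delta>\<^sub>v > 0" and s: "\<bar>s\<bar> < \<delta>\<^sub>u / u"
  defines "g \<equiv> gcd u v"
  shows "real (card {a\<in>{..<u}. (\<gamma> + real a) / u + s \<in> approx_set \<gamma> \<delta>\<^sub>v v}) \<le>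
    (if int_dist ((real v - real u) / g * \<gamma>) < (u * \<delta>\<^sub>v + v * \<delta>\<^sub>u) / g then 2 * u * \<delta>\<^sub>v + g else 0)"
proof -
  define u' v' where "u' = u div g" and "v' = v div g"
  have g: "g > 0" using u by (simp add: g_def)
  have uv: "u = g * u'" "v = g * v'" by (auto simp: u'_def v'_def g_def)
  have u': "u' > 0" using uv u by (cases u') auto
  have cop: "coprime u' v'" unfolding u'_def v'_def g_def using u by (intro div_gcd_coprime) auto
  define \<phi> where "\<phi> = v * \<gamma> / u + v * s - \<gamma>"
  define T where "T = {a\<in>{..<u}. (\<gamma> + real a) / u + s \<in> approx_set \<gamma> \<delta>\<^sub>v v}"
  define B where "B = {b::int. \<bar>of_int b + u' * \<phi>\<bar> < u' * \<delta>\<^sub>v}"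
  \<comment> \<open>\<open>f a\<close> is the integer b: it is congruent to \<open>v' * a\<close>
    modulo \<open>u'\<close>, and \<open>f a + u' * \<phi>\<close> is \<open>u'\<close> times the
    signed distance of v x - \<gamma> to the nearest integer, x being the point of arc
    \<open>a\<close> at offset \<open>s\<close>.\<close>
  define f where "f = (\<lambda>a::nat. int v' * int a - int u' * round (real v' * a / u' + \<phi>))"
  have arg: "real v * ((\<gamma> + real a) / u + s) - \<gamma> = real v' * a / u' + \<phi>" for a :: nat
    using u u' g by (simp add: \<phi>_def uv field_simps)
  have fB: "f a \<in> B" if "a \<in> T" for a
  proof -
    let ?y = "real v' * a / u' + \<phi>"
    have "\<bar>?y - of_int (round ?y)\<bar> < \<delta>\<^sub>v"
      using that unfolding T_def approx_set_def by (simp add: arg int_dist_def)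
    then have "u' * \<bar>?y - of_int (round ?y)\<bar> < u' * \<delta>\<^sub>v" using u' by (intro mult_strict_left_mono) auto
    moreover have "of_int (f a) + u' * \<phi> = u' * (?y - of_int (round ?y))"
      using u' by (simp add: f_def field_simps)
    ultimately show ?thesis by (simp add: B_def abs_mult)
  qed
  have inj: "inj_on (\<lambda>a. (f a, a div u')) T"
  proof (rule inj_onI)
    fix a b assume ab: "a \<in> T" "b \<in> T" "(f a, a div u') = (f b, b div u')"
    then have eq: "int v' * (int a - int b) = int u' * (round (real v' * a / u' + \<phi>) - round (real v' * b / u' + \<phi>))"
      by (simp add: f_def algebra_simps)
    then have "int u' dvd int v' * (int a - int b)" by simp
    then have "int u' dvd int a - int b" using cop by (simp add: coprime_dvd_mult_right_iff)
    then have "a mod u' = b mod u'"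
      by (metis mod_eq_dvd_iff of_nat_eq_iff zmod_int)
    then show "a = b" using ab(3) by (metis div_mult_mod_eq prod.inject)
  qed
  have "(\<lambda>a. (f a, a div u')) ` T \<subseteq> B \<times> {..<g}"
    using fB u' by (auto simp: T_def uv div_less_iff_less_mult mult.commute)
  moreover have finB: "finite B" unfolding B_def using u' dv by (intro card_int_near_le) auto
  ultimately have "card T \<le> card (B \<times> {..<g})"
    using inj by (intro card_inj_on_le) auto
  then have "real (card T) \<le> real (card B) * g" by (simp add: card_cartesian_product flip: of_nat_mult)
  also have "\<dots> \<le> (if B = {} then 0 else (2 * (u' * \<delta>\<^sub>v) + 1) * g)"
    using u' dv by (auto simp: B_def intro!: mult_right_mono card_int_near_le(2))
  also have "\<dots> \<le> (if int_dist ((real v - real u) / g * \<gamma>) < (u * \<delta>\<^sub>v + v * \<delta>\<^sub>u) / g then 2 * u * \<delta>\<^sub>v + g else 0)"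
  proof (cases "B = {}")
    case True
    have "0 \<le> 2 * real u * \<delta>\<^sub>v + g" using dv by simp
    then show ?thesis using True by simp
  next
    case False
    then obtain b where b: "\<bar>of_int b + u' * \<phi>\<bar> < u' * \<delta>\<^sub>v" by (auto simp: B_def)
    have su: "\<bar>s\<bar> * u < \<delta>\<^sub>u" using s u by (simp add: field_simps)
    \<comment> \<open>Here the arithmetic condition on \<gamma> appears: if some b is admissible, (v
      - u) \<gamma> / g is close to the integer -b, up to the error from the offset
      \<open>s\<close>.\<close>
    have "u' * \<phi> = (real v - real u) / g * \<gamma> + v' * (s * u)"
      using u u' g by (simp add: \<phi>_def uv field_simps)
    moreover have "\<bar>x - of_int (- b)\<bar> \<le> \<bar>of_int b + y\<bar> + \<bar>w\<bar>" if "y = x + w" for x y w :: real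
      using that by simp
    ultimately have "\<bar>(real v - real u) / g * \<gamma> - of_int (- b)\<bar> \<le> \<bar>of_int b + u' * \<phi>\<bar> + \<bar>v' * (s * u)\<bar>" by blast
    also have "\<bar>v' * (s * u)\<bar> = v' * (\<bar>s\<bar> * u)" by (simp add: abs_mult)
    also have "\<bar>of_int b + u' * \<phi>\<bar> + v' * (\<bar>s\<bar> * u) < u' * \<delta>\<^sub>v + v' * \<delta>\<^sub>u"
      using b su by (intro add_less_le_mono mult_left_mono) auto
    also have "\<dots> = (u * \<delta>\<^sub>v + v * \<delta>\<^sub>u) / g" using g by (simp add: uv field_simps)
    finally have "int_dist ((real v - real u) / g * \<gamma>) < (u * \<delta>\<^sub>v + v * \<delta>\<^sub>u) / g"
      using int_dist_le order_le_less_trans by blast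
    then show ?thesis using False by (simp add: uv algebra_simps)
  qed
  finally show ?thesis by (simp add: T_def)
qed

lemma emeasure_approx_set:
  assumes "q > 0" "0 \<le> \<delta>" "\<delta> \<le> 1/2"
  shows "emeasure lborel (approx_set \<gamma> \<delta> q \<inter> {0..<1}) = ennreal (2 * \<delta>)"
proof -
  have "emeasure lborel (approx_set \<gamma> \<delta> q \<inter> UNIV \<inter> {0..<1}) =
     (\<integral>\<^sup>+s\<in>{-(\<delta> / q)<..<\<delta> / q}. of_nat (card {a\<in>{..<q}. (\<gamma> + real a) / q + s \<in> UNIV}) \<partial>lborel)"
    using assms by (intro emeasure_approx_set_Int) auto
  also have "\<dots> = of_nat q * ennreal (2 * (\<delta> / q))"
    using assms by (simp add: nn_integral_cmult_indicator)
  also have "\<dots> = ennreal (2 * \<delta>)"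
    using assms by (simp add: ennreal_of_nat_eq_real_of_nat ennreal_mult[symmetric])
  finally show ?thesis by simp
qed

text \<open>The number of arcs is bounded uniformly in the offset, so it is multiplied by the length
  \<open>2 * \<delta>\<^sub>u / u\<close> of the offset range. The part
  \<open>2 * u * \<delta>\<^sub>v\<close> of the count yields the product of the two measures, and
  \<open>g\<close> yields the excess.\<close>

lemma emeasure_approx_set_Int_approx_set_le:
  fixes \<gamma> \<delta>\<^sub>u \<delta>\<^sub>v :: real and u v :: nat
  assumes u: "u > 0" and v: "v > 0" and d: "0 \<le> \<delta>\<^sub>u" "\<delta>\<^sub>u \<le> 1/2" "\<delta>\<^sub>v > 0"
  defines "g \<equiv> gcd u v"
  shows "emeasure lborel (approx_set \<gamma> \<delta>\<^sub>u u \<inter> approx_set \<gamma> \<delta>\<^sub>v v \<inter> {0..<1}) \<le>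
    ennreal (4 * \<delta>\<^sub>u * \<delta>\<^sub>v +
      (if int_dist ((real v - real u) / g * \<gamma>) < (u * \<delta>\<^sub>v + v * \<delta>\<^sub>u) / g then 2 * real g * \<delta>\<^sub>u / u else 0))"
proof -
  define K where "K = (if int_dist ((real v - real u) / g * \<gamma>) < (u * \<delta>\<^sub>v + v * \<delta>\<^sub>u) / g then 2 * u * \<delta>\<^sub>v + g else 0)"
  have K: "K \<ge> 0" using d by (simp add: K_def)
  have "emeasure lborel (approx_set \<gamma> \<delta>\<^sub>u u \<inter> approx_set \<gamma> \<delta>\<^sub>v v \<inter> {0..<1}) =
     (\<integral>\<^sup>+s\<in>{-(\<delta>\<^sub>u / u)<..<\<delta>\<^sub>u / u}. of_nat (card {a\<in>{..<u}. (\<gamma> + real a) / u + s \<in> approx_set \<gamma> \<delta>\<^sub>v v}) \<partial>lborel)"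
    using assms approx_set_periodic open_approx_set by (intro emeasure_approx_set_Int) auto
  also have "\<dots> \<le> (\<integral>\<^sup>+s\<in>{-(\<delta>\<^sub>u / u)<..<\<delta>\<^sub>u / u}. ennreal K \<partial>lborel)"
  proof (intro nn_integral_mono)
    fix s
    show "of_nat (card {a\<in>{..<u}. (\<gamma> + real a) / u + s \<in> approx_set \<gamma> \<delta>\<^sub>v v}) * indicator {-(\<delta>\<^sub>u / u)<..<\<delta>\<^sub>u / u} s
      \<le> ennreal K * indicator {-(\<delta>\<^sub>u / u)<..<\<delta>\<^sub>u / u} s"
    proof (cases "s \<in> {-(\<delta>\<^sub>u / u)<..<\<delta>\<^sub>u / u}")
      case True
      then have "\<bar>s\<bar> < \<delta>\<^sub>u / u" by (auto simp: abs_less_iff)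
      from card_arcs_in_approx_set_le[OF u v d(3) this, of \<gamma>] True show ?thesis
        unfolding K_def g_def by (simp add: ennreal_of_nat_eq_real_of_nat ennreal_leI)
    qed simp
  qed
  also have "\<dots> = ennreal K * ennreal (2 * (\<delta>\<^sub>u / u))" using d u by (simp add: nn_integral_cmult_indicator)
  also have "\<dots> = ennreal (K * (2 * (\<delta>\<^sub>u / u)))" using K d u by (intro ennreal_mult[symmetric]) auto
  also have "\<dots> \<le> ennreal (4 * \<delta>\<^sub>u * \<delta>\<^sub>v +
      (if int_dist ((real v - real u) / g * \<gamma>) < (u * \<delta>\<^sub>v + v * \<delta>\<^sub>u) / g then 2 * real g * \<delta>\<^sub>u / u else 0))"
    using u d by (intro ennreal_leI) (simp add: K_def field_simps)
  finally show ?thesis .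
qed

section \<open>Second moment method\<close>

text \<open>Chebyshev's inequality for the number \<open>X\<close> of events that occur: where none
  occurs, (X - \<mu>)^2 equals \<mu>^2, while its expectation is at most \<open>K\<close>.\<close>

lemma (in prob_space) prob_no_event_le:
  assumes F: "finite F" and A: "\<And>i. i \<in> F \<Longrightarrow> A i \<in> events"
  defines "\<mu> \<equiv> \<Sum>i\<in>F. prob (A i)"
  assumes pos: "\<mu> > 0" and pair: "(\<Sum>i\<in>F. \<Sum>j\<in>F. prob (A i \<inter> A j)) \<le> \<mu>\<^sup>2 + K"
  shows "prob (space M - (\<Union>i\<in>F. A i)) \<le> K / \<mu>\<^sup>2"
proof -
  define N where "N = space M - (\<Union>i\<in>F. A i)"
  define X where "X = (\<lambda>x. \<Sum>i\<in>F. indicator (A i) x :: real)"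
  have N: "N \<in> events" unfolding N_def using F A by auto
  have XX: "(X x)\<^sup>2 = (\<Sum>i\<in>F. \<Sum>j\<in>F. indicator (A i \<inter> A j) x)" for x
    by (simp add: X_def power2_eq_square sum_product indicator_inter_arith)
  have sq: "(X x - \<mu>)\<^sup>2 = (\<Sum>i\<in>F. \<Sum>j\<in>F. indicator (A i \<inter> A j) x) - 2 * \<mu> * X x + \<mu>\<^sup>2" for x
    by (simp add: XX[symmetric] power2_diff)
  have i2: "integrable M (\<lambda>x. \<Sum>i\<in>F. \<Sum>j\<in>F. indicator (A i \<inter> A j) x :: real)"
    using A by (intro Bochner_Integration.integrable_sum) (auto simp: less_top[symmetric])
  have i1: "integrable M X"
    unfolding X_def using A by (intro Bochner_Integration.integrable_sum) (auto simp: less_top[symmetric])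
  have EX: "expectation X = \<mu>"
    unfolding X_def \<mu>_def using A
    by (subst Bochner_Integration.integral_sum) (auto simp: less_top[symmetric])
  have E2: "expectation (\<lambda>x. \<Sum>i\<in>F. \<Sum>j\<in>F. indicator (A i \<inter> A j) x) = (\<Sum>i\<in>F. \<Sum>j\<in>F. prob (A i \<inter> A j))"
  proof -
    have int: "integrable M (indicator (A i \<inter> A j) :: 'a \<Rightarrow> real)" if "i \<in> F" "j \<in> F" for i j
    proof -
      have "A i \<inter> A j \<in> events" using A that by auto
      then show ?thesis by (rule integrable_real_indicator) (simp add: emeasure_eq_measure)
    qed
    have "expectation (\<lambda>x. \<Sum>i\<in>F. \<Sum>j\<in>F. indicator (A i \<inter> A j) x :: real)
      = (\<Sum>i\<in>F. expectation (\<lambda>x. \<Sum>j\<in>F. indicator (A i \<inter> A j) x))"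
      by (intro Bochner_Integration.integral_sum Bochner_Integration.integrable_sum int)
    also have "\<dots> = (\<Sum>i\<in>F. \<Sum>j\<in>F. expectation (indicator (A i \<inter> A j)))"
      by (intro sum.cong refl Bochner_Integration.integral_sum int)
    also have "\<dots> = (\<Sum>i\<in>F. \<Sum>j\<in>F. prob (A i \<inter> A j))"
      using A by (intro sum.cong refl) simp
    finally show ?thesis .
  qed
  have "\<mu>\<^sup>2 * prob N = expectation (\<lambda>x. \<mu>\<^sup>2 * indicator N x)" using N by simp
  also have "\<dots> \<le> expectation (\<lambda>x. (\<Sum>i\<in>F. \<Sum>j\<in>F. indicator (A i \<inter> A j) x) - 2 * \<mu> * X x + \<mu>\<^sup>2)"
  proof (rule integral_mono)
    show "integrable M (\<lambda>x. \<mu>\<^sup>2 * indicator N x)" using N by (auto simp: less_top[symmetric])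
    show "integrable M (\<lambda>x. (\<Sum>i\<in>F. \<Sum>j\<in>F. indicator (A i \<inter> A j) x) - 2 * \<mu> * X x + \<mu>\<^sup>2)"
      using i1 i2 by auto
    fix x
    have "X x = 0" if "x \<in> N" using that by (simp add: X_def N_def)
    then have "\<mu>\<^sup>2 * indicator N x \<le> (X x - \<mu>)\<^sup>2" by (cases "x \<in> N") auto
    then show "\<mu>\<^sup>2 * indicator N x \<le> (\<Sum>i\<in>F. \<Sum>j\<in>F. indicator (A i \<inter> A j) x) - 2 * \<mu> * X x + \<mu>\<^sup>2"
      by (simp only: sq)
  qed
  also have "\<dots> = (\<Sum>i\<in>F. \<Sum>j\<in>F. prob (A i \<inter> A j)) - 2 * \<mu> * \<mu> + \<mu>\<^sup>2"
    using i1 i2 by (simp add: EX E2 prob_space)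
  also have "\<dots> \<le> K" using pair by (simp add: power2_eq_square)
  finally show ?thesis using pos by (simp add: N_def field_simps)
qed

text \<open>The excess of each pair is charged to the index \<open>u\<close> with the smaller ratio,
  and \<open>overlap\<close> limits the total charge to \<open>2 * C * \<delta> u\<close>. The
  variance is thus at most \<open>(1 + 2 * C) * \<mu>\<close>. Since \<mu> can be made arbitrarily
  large, the probability of missing every set is 0.\<close>

lemma approx_sets_cover_almost_all:
  fixes \<gamma> C :: real and \<delta> :: "nat \<Rightarrow> real" and S :: "nat set"
  assumes S: "\<And>q. q \<in> S \<Longrightarrow> q > 0 \<and> 0 < \<delta> q \<and> \<delta> q \<le> 1/2"
    and overlap: "\<And>u V. u \<in> S \<Longrightarrow> finite V \<Longrightarrow> V \<subseteq> S - {u} \<Longrightarrow> (\<And>v. v \<in> V \<Longrightarrow> \<delta> u / u \<le> \<delta> v / v) \<Longrightarrow>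
      (\<Sum>v\<in>V. if int_dist ((real v - real u) / gcd u v * \<gamma>) < 2 * real u * \<delta> v / gcd u v then real (gcd u v) else 0) \<le> C * u"
    and div: "\<And>B. \<exists>F. finite F \<and> F \<subseteq> S \<and> B \<le> (\<Sum>q\<in>F. \<delta> q)"
  shows "emeasure lborel ({0..<1} - (\<Union>q\<in>S. approx_set \<gamma> (\<delta> q) q)) = 0"
proof -
  define M where "M = restrict_space lborel {0..<1::real}"
  have emM: "emeasure M A = emeasure lborel A" if "A \<subseteq> {0..<1}" for A
    using that unfolding M_def by (intro emeasure_restrict_space) auto
  have spM: "space M = {0..<1}" by (simp add: M_def space_restrict_space)
  interpret prob_space M by (rule prob_spaceI) (simp add: emM spM)
  define A where "A = (\<lambda>q. approx_set \<gamma> (\<delta> q) q \<inter> {0..<1})"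
  have Aev: "A q \<in> events" for q
    unfolding M_def A_def using open_approx_set by (auto simp: sets_restrict_space_iff)
  have pA: "prob (A q) = 2 * \<delta> q" if "q \<in> S" for q
    using S[OF that] emeasure_approx_set[of q "\<delta> q" \<gamma>]
    by (simp add: A_def emM measure_def)
  \<comment> \<open>The excess charged to the first index; it vanishes when the first index has the
    larger ratio.\<close>
  define t where "t = (\<lambda>u v. if \<delta> u / u \<le> \<delta> v / v \<and> int_dist ((real v - real u) / gcd u v * \<gamma>) < 2 * real u * \<delta> v / gcd u v
      then 2 * real (gcd u v) * \<delta> u / u else 0)"
  have t0: "0 \<le> t u v" if "u \<in> S" for u v using S[OF that] by (simp add: t_def)
  have one_side: "prob (A u \<inter> A v) \<le> 4 * \<delta> u * \<delta> v + t u v"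
    if uv: "u \<in> S" "v \<in> S" and le: "\<delta> u / u \<le> \<delta> v / v" for u v
  proof -
    have u: "u > 0" "0 \<le> \<delta> u" "\<delta> u \<le> 1/2" and v: "v > 0" "\<delta> v > 0" using S[OF uv(1)] S[OF uv(2)] by auto
    let ?c = "int_dist ((real v - real u) / gcd u v * \<gamma>)"
    \<comment> \<open>The ordering of the ratios turns the symmetric tolerance into one that
      involves only \<open>u\<close> and \<open>\<delta> v\<close>.\<close>
    have "v * \<delta> u \<le> u * \<delta> v" using le u v by (simp add: field_simps)
    then have "(u * \<delta> v + v * \<delta> u) / gcd u v \<le> 2 * real u * \<delta> v / gcd u v" by (intro divide_right_mono) auto
    then have *: "(if ?c < (u * \<delta> v + v * \<delta> u) / gcd u v then 2 * real (gcd u v) * \<delta> u / u else 0) \<le> t u v"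
      using le t0[OF uv(1), of v] by (auto simp: t_def)
    have "ennreal (prob (A u \<inter> A v)) = emeasure lborel (approx_set \<gamma> (\<delta> u) u \<inter> approx_set \<gamma> (\<delta> v) v \<inter> {0..<1})"
      unfolding emeasure_eq_measure[symmetric] by (subst emM) (auto simp: A_def intro!: arg_cong[where f = "emeasure lborel"])
    also have "\<dots> \<le> ennreal (4 * \<delta> u * \<delta> v + (if ?c < (u * \<delta> v + v * \<delta> u) / gcd u v then 2 * real (gcd u v) * \<delta> u / u else 0))"
      by (intro emeasure_approx_set_Int_approx_set_le u v)
    also have "\<dots> \<le> ennreal (4 * \<delta> u * \<delta> v + t u v)" using * by (intro ennreal_leI) simp
    finally show ?thesis using u v t0[OF uv(1), of v] by (subst (asm) ennreal_le_iff) auto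
  qed
  have two_side: "prob (A u \<inter> A v) \<le> 4 * \<delta> u * \<delta> v + (t u v + t v u)" if uv: "u \<in> S" "v \<in> S" for u v
  proof (cases "\<delta> u / u \<le> \<delta> v / v")
    case True
    then show ?thesis using one_side[OF uv] t0[OF uv(2), of u] by linarith
  next
    case False
    then show ?thesis using one_side[OF uv(2,1)] t0[OF uv(1), of v] by (simp add: Int_commute mult_ac)
  qed
  have tsum: "(\<Sum>v\<in>F - {u}. t u v) \<le> 2 * C * \<delta> u" if F: "finite F" "F \<subseteq> S" "u \<in> F" for F u
  proof -
    have u: "u > 0" "0 < \<delta> u" "u \<in> S" using S F by auto
    define V where "V = {v\<in>F - {u}. \<delta> u / u \<le> \<delta> v / v}"
    let ?f = "\<lambda>v. if int_dist ((real v - real u) / gcd u v * \<gamma>) < 2 * real u * \<delta> v / gcd u v then real (gcd u v) else 0"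
    have "(\<Sum>v\<in>F - {u}. t u v) = (\<Sum>v\<in>V. t u v)"
      unfolding V_def using F by (intro sum.mono_neutral_right) (auto simp: t_def)
    also have "\<dots> = (\<Sum>v\<in>V. 2 * \<delta> u / u * ?f v)"
      by (intro sum.cong) (auto simp: V_def t_def)
    also have "\<dots> = 2 * \<delta> u / u * (\<Sum>v\<in>V. ?f v)" by (simp add: sum_distrib_left)
    also have "\<dots> \<le> 2 * \<delta> u / u * (C * u)"
    proof (rule mult_left_mono)
      show "(\<Sum>v\<in>V. ?f v) \<le> C * u" by (rule overlap) (use u F in \<open>auto simp: V_def\<close>)
    qed (use u in auto)
    also have "\<dots> = 2 * C * \<delta> u" using u by simp
    finally show ?thesis .
  qed
  define Z where "Z = space M - (\<Union>q\<in>S. A q)"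
  have Zev: "Z \<in> events" unfolding Z_def using Aev by (intro sets.Diff sets.top sets.countable_UN') auto
  have C: "C \<ge> 0"
  proof -
    obtain F where F: "finite F" "F \<subseteq> S" "1 \<le> (\<Sum>q\<in>F. \<delta> q)" using div by blast
    then obtain u where "u \<in> F" by (cases "F = {}") auto
    then have "0 \<le> C * u" "u > 0" using overlap[of u "{}"] S F by auto
    then show ?thesis by (simp add: zero_le_mult_iff)
  qed
  have bound: "prob Z \<le> (1 + 2 * C) / (2 * B)" if B: "B > 0" for B
  proof -
    obtain F where F: "finite F" "F \<subseteq> S" "B \<le> (\<Sum>q\<in>F. \<delta> q)" using div by blast
    define \<mu> where "\<mu> = (\<Sum>q\<in>F. prob (A q))"
    have mu: "\<mu> = (\<Sum>q\<in>F. 2 * \<delta> q)" unfolding \<mu>_def using F pA by (intro sum.cong) auto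
    have muB: "2 * B \<le> \<mu>" using F(3) by (simp add: mu sum_distrib_left[symmetric])
    have "(\<Sum>u\<in>F. \<Sum>v\<in>F. prob (A u \<inter> A v)) = (\<Sum>u\<in>F. prob (A u) + (\<Sum>v\<in>F - {u}. prob (A u \<inter> A v)))"
      using F by (intro sum.cong refl) (simp add: sum.remove)
    also have "\<dots> \<le> (\<Sum>u\<in>F. prob (A u) + (\<Sum>v\<in>F - {u}. 4 * \<delta> u * \<delta> v + (t u v + t v u)))"
      using F two_side by (intro sum_mono add_mono) auto
    also have "\<dots> = \<mu> + (\<Sum>u\<in>F. \<Sum>v\<in>F - {u}. 4 * \<delta> u * \<delta> v) + ((\<Sum>u\<in>F. \<Sum>v\<in>F - {u}. t u v) + (\<Sum>u\<in>F. \<Sum>v\<in>F - {u}. t v u))"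
      by (simp add: sum.distrib \<mu>_def)
    also have "(\<Sum>u\<in>F. \<Sum>v\<in>F - {u}. t v u) = (\<Sum>u\<in>F. \<Sum>v\<in>F - {u}. t u v)"
    proof -
      have *: "F - {u} = {v\<in>F. u \<noteq> v}" for u by auto
      have **: "{v\<in>F. u \<noteq> v} = {v\<in>F. v \<noteq> u}" for u by auto
      show ?thesis unfolding * by (subst sum.swap_restrict) (simp_all only: F **)
    qed
    also have "(\<Sum>u\<in>F. \<Sum>v\<in>F - {u}. 4 * \<delta> u * \<delta> v) \<le> (\<Sum>u\<in>F. \<Sum>v\<in>F. 4 * \<delta> u * \<delta> v)"
      using F S by (intro sum_mono sum_mono2) (auto intro!: mult_nonneg_nonneg less_imp_le)
    also have "\<dots> = \<mu>\<^sup>2" by (simp add: mu power2_eq_square sum_product mult_ac)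
    also have "(\<Sum>u\<in>F. \<Sum>v\<in>F - {u}. t u v) \<le> (\<Sum>u\<in>F. 2 * C * \<delta> u)" using F by (intro sum_mono tsum)
    also have "\<dots> = C * \<mu>" by (simp add: mu sum_distrib_left mult_ac)
    finally have pair: "(\<Sum>u\<in>F. \<Sum>v\<in>F. prob (A u \<inter> A v)) \<le> \<mu>\<^sup>2 + (1 + 2 * C) * \<mu>"
      by (simp add: algebra_simps)
    have "prob Z \<le> prob (space M - (\<Union>q\<in>F. A q))"
      using F Aev by (intro finite_measure_mono) (auto simp: Z_def)
    also have "\<dots> \<le> (1 + 2 * C) * \<mu> / \<mu>\<^sup>2"
      using pair F muB B Aev unfolding \<mu>_def by (intro prob_no_event_le) auto
    also have "\<dots> = (1 + 2 * C) / \<mu>" by (simp add: power2_eq_square)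
    also have "\<dots> \<le> (1 + 2 * C) / (2 * B)" using muB B C by (intro divide_left_mono) auto
    finally show ?thesis .
  qed
  have "prob Z \<le> 0"
  proof (rule ccontr)
    assume "\<not> prob Z \<le> 0"
    then have p: "prob Z > 0" by simp
    \<comment> \<open>With this \<open>B\<close> the bound reads
      \<open>prob Z \<le> prob Z / 2\<close>.\<close>
    define B where "B = (1 + 2 * C) / prob Z"
    have "B > 0" using p C by (simp add: B_def)
    from bound[OF this] have "prob Z \<le> (1 + 2 * C) / (2 * B)" .
    also have "\<dots> = prob Z / 2"
    proof -
      have "x / (2 * (x / y)) = y / 2" if "x > 0" "y > 0" for x y :: real
        using that by simp
      then show ?thesis using p C by (simp only: B_def)
    qed
    finally have "prob Z \<le> prob Z / 2" .
    then show False using p by simp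
  qed
  then have "emeasure M Z = 0" by (simp add: emeasure_eq_measure measure_le_0_iff)
  moreover have "Z = {0..<1} - (\<Union>q\<in>S. approx_set \<gamma> (\<delta> q) q)" by (auto simp: Z_def spM A_def)
  ultimately show ?thesis by (subst (asm) emM) auto
qed

section \<open>Indices with large overlap\<close>

lemma sum_gcd_le_sum_divisors:
  fixes h :: "nat \<Rightarrow> real"
  assumes "finite V" "u > 0"
    and "\<And>g. g dvd u \<Longrightarrow> real g * real (card {v\<in>V. gcd u v = g}) \<le> h g"
  shows "(\<Sum>v\<in>V. real (gcd u v)) \<le> (\<Sum>g | g dvd u. h g)"
proof -
  have "(\<Sum>v\<in>V. real (gcd u v)) = (\<Sum>g | g dvd u. \<Sum>v | v \<in> V \<and> gcd u v = g. real (gcd u v))"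
    using assms by (intro sum.group[symmetric]) auto
  also have "\<dots> = (\<Sum>g | g dvd u. real g * real (card {v\<in>V. gcd u v = g}))"
    by (intro sum.cong refl) simp
  also have "\<dots> \<le> (\<Sum>g | g dvd u. h g)"
    using assms by (intro sum_mono) auto
  finally show ?thesis .
qed

text \<open>Used to let two competing bounds for a dyadic class produce decay in both of its
  parameters at once.\<close>

lemma min_le_geometric_mean:
  fixes a b \<theta> :: real
  assumes "a > 0" "b > 0" "0 \<le> \<theta>" "\<theta> \<le> 1" "x \<le> a" "x \<le> b" "x \<ge> 0"
  shows "x \<le> a powr \<theta> * b powr (1 - \<theta>)"
proof (cases "x = 0")
  case False
  then have "x = x powr \<theta> * x powr (1 - \<theta>)" using assms by (simp flip: powr_add)
  also have "\<dots> \<le> a powr \<theta> * b powr (1 - \<theta>)"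
    using assms by (intro mult_mono powr_mono2) auto
  finally show ?thesis .
qed simp

lemma sum_power_le_geometric:
  fixes q :: real
  assumes "0 \<le> q" "q < 1"
  shows "(\<Sum>j\<le>J. q ^ j) \<le> 1 / (1 - q)"
proof -
  have "(\<Sum>j\<le>J. q ^ j) = (1 - q ^ Suc J) / (1 - q)"
    using assms by (subst sum_gp0) simp
  also have "\<dots> \<le> 1 / (1 - q)" using assms by (intro divide_right_mono) auto
  finally show ?thesis .
qed

text \<open>The indices \<open>v\<close> overlapping too much with a fixed large \<open>u\<close> are called its partners.
  The bound \<open>1 / (u\<^sup>2 ln\<^sup>2 u) \<le> \<delta> v / v\<close> is all that is used of \<open>\<delta> u / u \<le> \<delta> v / v\<close>.\<close>
locale large_index =
  fixes c R t C \<gamma> \<beta> \<gamma>' :: real and \<delta> :: "nat \<Rightarrow> real" and u :: nat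
  assumes dio: "diophantine_with c R \<gamma> \<beta>" and t_def: "t = 1 / (40 * R\<^sup>2)" and C: "C \<ge> 1"
    and large_C: "2 * C \<le> real u powr t" and large_12: "12 \<le> real u powr t"
    and large_c: "1 / c \<le> real u powr t" and large_ln: "ln (real u) \<le> real u powr t"
    and large_ln2: "C * (ln (real u))\<^sup>2 < real u powr (t / 2)" and ln_ge_3: "3 \<le> ln (real u)"
begin

section \<open>Size of the partners of a fixed index\<close>

definition w :: "nat \<Rightarrow> real" where "w v = int_dist (real v * \<beta> - \<gamma>')"

definition partner :: "nat \<Rightarrow> bool" where
  "partner v \<longleftrightarrow> v \<ge> 3 \<and> v \<noteq> u \<and> real v powr (- t) \<le> w v \<and> \<delta> v \<le> C / (real v * ln (real v) * w v) \<and>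
     1 / ((real u)\<^sup>2 * (ln (real u))\<^sup>2) \<le> \<delta> v / real v \<and>
     int_dist ((real v - real u) / real (gcd u v) * \<gamma>) < 2 * real u * \<delta> v / real (gcd u v)"

lemma R_ge_1: "R \<ge> 1" and c_pos: "c > 0" using dio by (auto simp: diophantine_with_def)

lemma t_R: "t * R\<^sup>2 = 1/40" using R_ge_1 by (simp add: t_def)

text \<open>All later losses are powers of \<open>u\<close> with exponents that are small multiples
  of t, t R and t R^2; each of these is at most 1/40, which keeps the totals below 1.\<close>

lemma t_bounds: "0 < t" "t \<le> 1/40" "t \<le> t * R" "t * R \<le> 1/40"
proof -
  show t0: "0 < t" using R_ge_1 by (simp add: t_def)
  show "t \<le> t * R" using t0 R_ge_1 by simp
  have "t * R \<le> t * R * R" using t0 R_ge_1 by simp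
  then show "t * R \<le> 1/40" using t_R by (simp add: power2_eq_square mult_ac)
  with \<open>t \<le> t * R\<close> show "t \<le> 1/40" by linarith
qed

lemma u_gt_1: "u > 0" "real u > 1"
proof -
  show "u > 0" using ln_ge_3 by (cases u) auto
  show "real u > 1"
  proof (rule ccontr)
    assume "\<not> real u > 1"
    then have "ln (real u) \<le> 0" using \<open>u > 0\<close> by (simp add: ln_le_zero_iff)
    then show False using ln_ge_3 by linarith
  qed
qed

lemma u_powr_mono: "a \<le> b \<Longrightarrow> real u powr a \<le> real u powr b"
  using u_gt_1 by (intro powr_mono) auto

lemma partner_w: "partner v \<Longrightarrow> 0 < w v" "w v \<le> 1/2"
  using int_dist_le_half by (auto simp: partner_def w_def intro: less_le_trans[of _ "real v powr (-t)"])

lemma ln_partner_ge_1: "partner v \<Longrightarrow> 1 \<le> ln (real v)"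
proof -
  assume "partner v"
  then have "exp 1 \<le> real v" using exp_le by (auto simp: partner_def)
  then show ?thesis using \<open>partner v\<close> by (simp add: partner_def ln_ge_iff)
qed

text \<open>Allows \<open>ln v\<close> to be replaced by a multiple of \<open>ln u\<close> for
  indices that are not much smaller than \<open>u\<close>.\<close>

lemma ln_ge_half:
  assumes "real u powr (1 - t) \<le> x"
  shows "ln (real u) / 2 \<le> ln x"
proof -
  have pos: "0 < real u powr (1 - t)" using u_gt_1 by simp
  have "(1 - t) * ln (real u) = ln (real u powr (1 - t))" using u_gt_1 by (simp add: ln_powr)
  also have "\<dots> \<le> ln x" using assms pos by (subst ln_le_cancel_iff) linarith+
  finally have "(1 - t) * ln (real u) \<le> ln x" .
  moreover have "1/2 * ln (real u) \<le> (1 - t) * ln (real u)"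
    using t_bounds(1,2) ln_ge_3 by (intro mult_right_mono) auto
  ultimately show ?thesis by simp
qed

lemma partner_delta_le:
  assumes "partner v"
  shows "\<delta> v \<le> C * real v powr (t - 1)"
proof -
  have v: "v \<ge> 3" "real v powr (- t) \<le> w v" using assms by (auto simp: partner_def)
  have "\<delta> v \<le> C / (real v * ln (real v) * w v)" using assms by (simp add: partner_def)
  also have "\<dots> \<le> C / (real v * 1 * real v powr (- t))"
    using v C ln_partner_ge_1[OF assms] partner_w(1)[OF assms]
    by (intro divide_left_mono mult_mono mult_pos_pos) auto
  also have "\<dots> = C * real v powr (t - 1)" using v by (simp add: powr_diff powr_minus field_simps)
  finally show ?thesis .
qed

text \<open>The ratio \<open>\<delta> v / v\<close> is at most \<open>C * v powr (t - 2)\<close> but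
  at least 1 / (u^2 (ln u)^2). Beyond \<open>u powr (1 + t)\<close> the first is smaller by a factor
  \<open>u powr (t / 2)\<close>, which exceeds C (ln u)^2.\<close>

lemma partner_le:
  assumes "partner v"
  shows "real v \<le> real u powr (1 + t)"
proof (rule ccontr)
  assume "\<not> real v \<le> real u powr (1 + t)"
  then have v: "real u powr (1 + t) < real v" by simp
  let ?Y = "ln (real u)"
  have v3: "v \<ge> 3" using assms by (simp add: partner_def)
  have "1 / ((real u)\<^sup>2 * ?Y\<^sup>2) \<le> \<delta> v / real v" using assms by (simp add: partner_def)
  also have "\<dots> \<le> C * real v powr (t - 1) / real v"
    using partner_delta_le[OF assms] by (intro divide_right_mono) auto
  also have "\<dots> = C * real v powr (t - 2)" using v3 by (simp add: powr_diff powr_numeral power2_eq_square)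
  also have "real v powr (t - 2) \<le> (real u powr (1 + t)) powr (t - 2)"
    using v t_bounds(1,2) u_gt_1 by (intro powr_mono2') auto
  also have "(real u powr (1 + t)) powr (t - 2) = real u powr ((1 + t) * (t - 2))" by (simp add: powr_powr)
  also have "\<dots> \<le> real u powr (- 2 - t / 2)"
  proof (rule u_powr_mono)
    have "t * t \<le> t * (1/2)" using t_bounds(1,2) by (intro mult_left_mono) auto
    then show "(1 + t) * (t - 2) \<le> - 2 - t / 2" by (simp add: algebra_simps)
  qed
  also have "\<dots> = 1 / ((real u)\<^sup>2 * real u powr (t / 2))"
  proof -
    have "- 2 - t / 2 = - (2 + t / 2)" by simp
    then have "real u powr (- 2 - t / 2) = 1 / (real u powr 2 * real u powr (t / 2))"
      by (simp only: powr_minus_divide powr_add)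
    then show ?thesis using u_gt_1 by simp
  qed
  finally have "1 / ((real u)\<^sup>2 * ?Y\<^sup>2) \<le> C * (1 / ((real u)\<^sup>2 * real u powr (t / 2)))" using C by simp
  then have "real u powr (t / 2) \<le> C * ?Y\<^sup>2"
    using u_gt_1 ln_ge_3 by (simp add: field_simps)
  then show False using large_ln2 by simp
qed

section \<open>Partners with a given greatest common divisor\<close>

lemma card_gcd_eq_le:
  assumes "finite V" "g dvd u" "\<And>v. v \<in> V \<Longrightarrow> v > 0 \<and> real v \<le> x"
  shows "real g * real (card {v\<in>V. gcd u v = g}) \<le> x \<or> x < 0"
proof (cases "x < 0")
  case False
  have g: "g > 0" using assms(2) u_gt_1 by (auto intro: Nat.gr0I)
  have "(\<lambda>v. v div g) ` {v\<in>V. gcd u v = g} \<subseteq> {1..nat \<lfloor>x / g\<rfloor>}"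
  proof (intro image_subsetI)
    fix v assume "v \<in> {v\<in>V. gcd u v = g}"
    then have v: "v > 0" "real v \<le> x" "g dvd v" using assms(3)[of v] by auto
    then obtain n where n: "v = g * n" by auto
    then have "real n \<le> x / g" using v g by (simp add: field_simps)
    then show "v div g \<in> {1..nat \<lfloor>x / g\<rfloor>}" using n v g by (auto simp: le_nat_floor Suc_le_eq)
  qed
  moreover have "inj_on (\<lambda>v. v div g) {v\<in>V. gcd u v = g}"
    by (rule inj_onI) (metis (mono_tags, lifting) dvd_div_eq_iff gcd_dvd2 mem_Collect_eq)
  ultimately have "card {v\<in>V. gcd u v = g} \<le> card {1..nat \<lfloor>x / g\<rfloor>}"
    by (intro card_inj_on_le) auto
  then have "real (card {v\<in>V. gcd u v = g}) \<le> real (nat \<lfloor>x / g\<rfloor>)" by simp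
  also have "\<dots> \<le> x / g" using False g by (intro of_nat_floor) auto
  finally show ?thesis using g by (simp add: field_simps)
qed simp

text \<open>The cofactors n = v / g are counted instead of the partners v themselves: in terms of n
  the condition on \<gamma> is a Bohr condition with a fixed shift. Partners below
  \<open>u powr (1 - t)\<close> are left to a trivial count.\<close>

definition near :: "nat \<Rightarrow> nat set" where
  "near g = {n. partner (g * n) \<and> gcd u (g * n) = g \<and> real u powr (1 - t) \<le> real (g * n)}"

lemma card_near:
  assumes "finite V" "\<And>v. v \<in> V \<Longrightarrow> partner v \<and> real u powr (1 - t) \<le> real v" "g dvd u"
  obtains T where "T \<subseteq> near g" "finite T" "card {v\<in>V. gcd u v = g} = card T"
proof
  let ?T = "(\<lambda>v. v div g) ` {v\<in>V. gcd u v = g}"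
  show "finite ?T" using assms by simp
  show "?T \<subseteq> near g"
  proof (intro image_subsetI)
    fix v assume v: "v \<in> {v\<in>V. gcd u v = g}"
    then have eq: "g * (v div g) = v" and gcd: "gcd u v = g" and "v \<in> V" by auto
    then show "v div g \<in> near g" using assms(2)[of v] unfolding near_def by (simp only: mem_Collect_eq eq)
  qed
  have "inj_on (\<lambda>v. v div g) {v\<in>V. gcd u v = g}"
    by (rule inj_onI) (metis (mono_tags, lifting) dvd_div_eq_iff gcd_dvd2 mem_Collect_eq)
  then show "card {v\<in>V. gcd u v = g} = card ?T" by (simp add: card_image)
qed

text \<open>The shift comes from (v - u) / g = n - u / g. The final bound inserts v \<ge>
  \<open>u powr (1 - t)\<close> into the crude bound for \<delta> and absorbs \<open>2 * C\<close>
  into one more factor \<open>u powr t\<close>.\<close>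

lemma near_basic:
  assumes "g dvd u" "n \<in> near g"
  shows "g > 0" "n > 0" "real n \<le> real u powr (1 + t) / g" "n \<noteq> u div g"
    and "int_dist (real n * \<gamma> + - (real (u div g) * \<gamma>)) < 2 * real u * \<delta> (g * n) / g"
    and "2 * real u * \<delta> (g * n) / g \<le> real u powr (3 * t) / g"
proof -
  have p: "partner (g * n)" and gcd: "gcd u (g * n) = g" and ge: "real u powr (1 - t) \<le> real (g * n)"
    using assms(2) by (auto simp: near_def)
  show g: "g > 0" using assms(1) u_gt_1 by (auto intro: Nat.gr0I)
  show n: "n > 0" using p by (auto simp: partner_def intro: Nat.gr0I)
  have "real g * real n \<le> real u powr (1 + t)" using partner_le[OF p] by simp
  then show "real n \<le> real u powr (1 + t) / g" using g by (simp add: field_simps)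
  obtain u' where u': "u = g * u'" using assms(1) by auto
  have "g * n \<noteq> u" using p by (simp add: partner_def)
  then show "n \<noteq> u div g" using u' g by auto
  have "(real (g * n) - real u) / g * \<gamma> = real n * \<gamma> + - (real (u div g) * \<gamma>)"
    using g by (simp add: u' field_simps)
  then show "int_dist (real n * \<gamma> + - (real (u div g) * \<gamma>)) < 2 * real u * \<delta> (g * n) / g"
    using p unfolding partner_def gcd by metis
  have "\<delta> (g * n) \<le> C * real (g * n) powr (t - 1)" by (rule partner_delta_le[OF p])
  also have "real (g * n) powr (t - 1) \<le> (real u powr (1 - t)) powr (t - 1)"
    using ge t_bounds(1,2) u_gt_1 by (intro powr_mono2') auto
  also have "\<dots> = real u powr ((1 - t) * (t - 1))" by (simp add: powr_powr)
  also have "\<dots> \<le> real u powr (2 * t - 1)"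
    by (rule u_powr_mono) (simp add: algebra_simps)
  finally have "\<delta> (g * n) \<le> C * real u powr (2 * t - 1)" using C by simp
  then have "2 * real u * \<delta> (g * n) \<le> 2 * real u * (C * real u powr (2 * t - 1))"
    using u_gt_1 by (intro mult_left_mono) auto
  also have "\<dots> = 2 * C * real u powr (2 * t)" using u_gt_1 by (simp add: powr_diff field_simps)
  also have "\<dots> \<le> real u powr t * real u powr (2 * t)" using large_C by (intro mult_right_mono) auto
  also have "\<dots> = real u powr (3 * t)" by (simp flip: powr_add)
  finally show "2 * real u * \<delta> (g * n) / g \<le> real u powr (3 * t) / g" by (intro divide_right_mono) auto
qed

text \<open>For a huge common divisor the reduced indices are so small that the
  Diophantine condition leaves no solution at all.\<close>
lemma near_empty:
  assumes g: "g dvd u" and big: "real u powr (1 - 5 * t * R) < real g"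
  shows "near g = {}"
proof (rule ccontr)
  assume "near g \<noteq> {}"
  then obtain n where n: "n \<in> near g" by blast
  note nb = near_basic[OF g n]
  define u' where "u' = u div g"
  have uu: "u = g * u'" using g by (simp add: u'_def)
  define B where "B = real u powr (t + 5 * t * R)"
  have nB: "real n \<le> B"
  proof -
    have "real n \<le> real u powr (1 + t) / g" by (rule nb)
    also have "\<dots> \<le> real u powr (1 + t) / real u powr (1 - 5 * t * R)"
      using big u_gt_1 nb by (intro divide_left_mono) auto
    also have "\<dots> = B" by (simp add: B_def flip: powr_diff)
    finally show ?thesis .
  qed
  have uB: "real u' \<le> B"
  proof -
    have "real u' = real u / g" using nb(1) by (simp add: uu)
    also have "\<dots> \<le> real u / real u powr (1 - 5 * t * R)"
      using big u_gt_1 nb by (intro divide_left_mono) auto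
    also have "\<dots> = real u powr (5 * t * R)" using u_gt_1 by (simp add: powr_diff field_simps)
    also have "\<dots> \<le> B" unfolding B_def using t_bounds by (intro u_powr_mono) auto
    finally show ?thesis .
  qed
  \<comment> \<open>The coefficient of \<gamma> is nonzero because
    \<open>n \<noteq> u div g\<close>; \<beta> is not involved here.\<close>
  have "c * B powr (- R) \<le> int_dist (of_int (int n - int u') * \<gamma> + of_int 0 * \<beta>)"
    using nB uB nb(4) by (intro diophantine_withD[OF dio]) (auto simp: u'_def)
  also have "of_int (int n - int u') * \<gamma> + of_int 0 * \<beta> = real n * \<gamma> + - (real (u div g) * \<gamma>)"
    by (simp add: u'_def algebra_simps)
  also have "int_dist \<dots> \<le> real u powr (3 * t) / g" using nb(5,6) by linarith
  also have "\<dots> \<le> real u powr (3 * t) / real u powr (1 - 5 * t * R)"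
    using big u_gt_1 nb by (intro divide_left_mono) auto
  also have "\<dots> = real u powr (3 * t - 1 + 5 * t * R)" by (simp add: algebra_simps flip: powr_diff)
  finally have "c \<le> real u powr (3 * t - 1 + 5 * t * R) / B powr (- R)"
    using u_gt_1 by (simp add: B_def field_simps)
  also have "\<dots> = real u powr (3 * t - 1 + 5 * t * R + (t + 5 * t * R) * R)"
    by (simp add: B_def powr_powr powr_minus_divide divide_inverse[symmetric] flip: powr_add)
  \<comment> \<open>Apart from -1, the exponent consists of terms adding up to at most
    14/40.\<close>
  also have "\<dots> \<le> real u powr (- (1/2))"
  proof (rule u_powr_mono)
    have "(t + 5 * t * R) * R = 5 * (t * R\<^sup>2) + t * R" by (simp add: algebra_simps power2_eq_square)
    then show "3 * t - 1 + 5 * t * R + (t + 5 * t * R) * R \<le> - (1/2)" using t_bounds t_R by linarith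
  qed
  also have "\<dots> < real u powr (- t)" using u_gt_1 t_bounds(1,2) by (intro powr_less_mono) auto
  also have "\<dots> = 1 / real u powr t" by (simp add: powr_minus_divide)
  also have "\<dots> \<le> c" using large_c c_pos u_gt_1 by (simp add: field_simps)
  finally show False by simp
qed

text \<open>Only the condition on \<gamma> is used, that is \<open>M\<^sub>2 = 1\<close>. The main
  term saves a factor \<open>u powr (3 * t)\<close> over the trivial count. In the error term
  \<open>g\<close> may be taken at most \<open>u powr (1 - 5 * t * R)\<close>, as
  \<open>near g\<close> is empty otherwise, and this outweighs
  \<open>(2 * z) powr R\<close>.\<close>

lemma card_near_large_divisor:
  assumes g: "g dvd u" and big: "real u powr (7 * t) < real g" and T: "T \<subseteq> near g"
  shows "real g * real (card T) \<le> (8 + 4 * 2 powr R / c) * real u powr (1 - t)"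
proof (cases "real u powr (1 - 5 * t * R) < real g")
  case True
  then have "T = {}" using T near_empty[OF g] by auto
  then show ?thesis using c_pos by simp
next
  case False
  then have small: "real g \<le> real u powr (1 - 5 * t * R)" by simp
  \<comment> \<open>For g > \<open>u powr (7 * t)\<close> the tolerance is below
    \<open>u powr (- 4 * t)\<close>, so \<open>z\<close> times it is at most
    \<open>u powr (- t)\<close>, hence at most 1/12.\<close>
  define z where "z = real u powr (3 * t)"
  have z1: "z \<ge> 1" unfolding z_def using u_gt_1 t_bounds by (intro ge_one_powr_ge_zero) auto
  define M where "M = nat \<lceil>z\<rceil>"
  have M: "z \<le> real M" "real M \<le> 2 * z" "1 \<le> M" "real (M - 1) \<le> z"
    using z1 unfolding M_def by linarith+
  have g0: "g > 0" using g u_gt_1 by (auto intro: Nat.gr0I)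
  have gu: "real g \<le> real u" using g u_gt_1 by (auto dest: dvd_imp_le)
  define X where "X = real u powr (1 + t) / g"
  have X1: "1 \<le> X"
  proof -
    have "real g \<le> real u powr 1" using gu u_gt_1 by simp
    also have "\<dots> \<le> real u powr (1 + t)" using t_bounds by (intro u_powr_mono) auto
    finally show ?thesis using g0 by (simp add: X_def)
  qed
  define N where "N = nat \<lfloor>X\<rfloor> + 1"
  have N: "real N \<le> 2 * X" using X1 unfolding N_def by linarith
  have "real (card T) \<le> 4 * (real N / (real M * real 1) + real (max M (1 * 1)) powr R / c)"
  proof (rule card_two_dim_bohr_le[OF dio])
    show "T \<subseteq> {0..<0 + N}"
    proof
      fix n assume "n \<in> T"
      then have "real n \<le> X" using near_basic(3)[OF g] T by (auto simp: X_def)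
      then show "n \<in> {0..<0 + N}" by (simp add: N_def less_Suc_eq_le le_nat_floor)
    qed
    fix n assume "n \<in> T"
    then have n: "n \<in> near g" using T by auto
    have "real (M - 1) * int_dist (real n * \<gamma> + - (real (u div g) * \<gamma>)) \<le> z * (real u powr (3 * t) / g)"
      using near_basic(5,6)[OF g n] M z1 by (intro mult_mono) auto
    also have "\<dots> \<le> z * (real u powr (3 * t) / real u powr (7 * t))"
      using big z1 u_gt_1 g0 by (intro mult_left_mono divide_left_mono) auto
    also have "\<dots> = real u powr (- t)" by (simp add: z_def flip: powr_diff powr_add)
    also have "\<dots> = 1 / real u powr t" by (simp add: powr_minus_divide)
    also have "\<dots> \<le> 1/12" using large_12 u_gt_1 by (intro divide_left_mono) auto
    finally show "real (M - 1) * int_dist (real n * \<gamma> + - (real (u div g) * \<gamma>)) \<le> 1/12" .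
    show "real (1 - 1) * int_dist (real n * real 1 * \<beta> + 0) \<le> 1/12" by simp
  qed (use M in auto)
  also have "\<dots> \<le> 4 * (2 * X / z + (2 * z) powr R / c)"
    using M N X1 z1 c_pos R_ge_1
    by (intro mult_left_mono add_mono frac_le divide_right_mono powr_mono2) auto
  finally have "real g * real (card T) \<le> real g * (4 * (2 * X / z + (2 * z) powr R / c))"
    by (rule mult_left_mono) simp
  also have "\<dots> = 8 * (real g * X / z) + 4 * (real g * (2 * z) powr R / c)" by (simp add: algebra_simps)
  also have "real g * X / z = real u powr (1 + t) / real u powr (3 * t)" using g0 by (simp add: X_def z_def)
  also have "\<dots> = real u powr (1 - 2 * t)" by (simp flip: powr_diff)
  also have "\<dots> \<le> real u powr (1 - t)" using t_bounds by (intro u_powr_mono) auto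
  also have "real g * (2 * z) powr R / c \<le> real u powr (1 - 5 * t * R) * (2 * z) powr R / c"
    using small c_pos by (intro divide_right_mono mult_right_mono) auto
  also have "(2 * z) powr R = 2 powr R * real u powr (3 * t * R)"
    using z1 by (simp add: powr_mult z_def powr_powr)
  also have "real u powr (1 - 5 * t * R) * (2 powr R * real u powr (3 * t * R)) / c
      = 2 powr R / c * real u powr (1 - 2 * (t * R))"
    by (simp add: algebra_simps flip: powr_add)
  also have "\<dots> \<le> 2 powr R / c * real u powr (1 - t)"
    using t_bounds c_pos by (intro mult_left_mono u_powr_mono) auto
  finally show ?thesis by (simp add: algebra_simps)
qed

text \<open>On a class with v / u about \<open>x\<close> and \<open>w v\<close> about 2^-j the large
  sieve gives \<open>16 * XU / (M\<^sub>1 * M\<^sub>2)\<close>. The first bound keeps only the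
  factor \<open>M\<^sub>2\<close> from \<beta>. The second keeps both, and then \<open>x\<close> and
  2^j cancel.\<close>

lemma card_near_class:
  fixes x :: real and j g :: nat
  assumes g: "g dvd u" and small: "real g \<le> real u powr (7 * t)" and T: "T \<subseteq> near g"
    and x: "x > 0" "\<And>n. n \<in> T \<Longrightarrow> x \<le> real (g * n) / u \<and> real (g * n) / u < 2 * x"
    and j: "\<And>n. n \<in> T \<Longrightarrow> (1/2) ^ Suc j < w (g * n) \<and> w (g * n) \<le> (1/2) ^ j"
  shows "real (card T) \<le> 18432 * C * (real u / g) * (x / 2 ^ j)"
    and "real (card T) \<le> 18432 * C * (real u / g) * (1 / (g * ln (real u)))"
proof -
  define Y where "Y = ln (real u)"
  have Y: "Y \<ge> 3" using ln_ge_3 by (simp add: Y_def)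
  have g0: "g > 0" using g u_gt_1 by (auto intro: Nat.gr0I)
  have "real (card T) \<le> 18432 * C * (real u / g) * (x / 2 ^ j) \<and>
    real (card T) \<le> 18432 * C * (real u / g) * (1 / (g * Y))"
  proof (cases "T = {}")
    case True
    then show ?thesis using C x Y by simp
  next
    case False
    \<comment> \<open>A member of the class confines \<open>x\<close> and 2^j to small powers of
      \<open>u\<close>, which the error estimate needs.\<close>
    then obtain n0 where n0: "n0 \<in> T" by blast
    define XU where "XU = x * real u / g"
    have nn0: "partner (g * n0)" "real u powr (1 - t) \<le> real (g * n0)" using n0 T by (auto simp: near_def)
    have x_le: "x \<le> real u powr t"
    proof -
      have "x \<le> real (g * n0) / u" using x(2)[OF n0] by simp
      also have "\<dots> \<le> real u powr (1 + t) / u" using partner_le[OF nn0(1)] u_gt_1 by (intro divide_right_mono) auto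
      also have "\<dots> = real u powr t" using u_gt_1 by (simp add: powr_add)
      finally show ?thesis .
    qed
    have x_ge: "real u powr (- t) / 2 \<le> x"
    proof -
      have "real u powr (- t) = real u powr (1 - t) / u" using u_gt_1 by (simp add: powr_diff powr_minus field_simps)
      also have "\<dots> \<le> real (g * n0) / u" using nn0 u_gt_1 by (intro divide_right_mono) auto
      also have "\<dots> \<le> 2 * x" using x(2)[OF n0] by simp
      finally show ?thesis by simp
    qed
    have j_le: "2 ^ j \<le> real u powr (2 * t)"
    proof -
      have "real u powr (- (2 * t)) \<le> real u powr ((1 + t) * (- t))"
      proof (rule u_powr_mono)
        have "t * t \<le> t * 1" using t_bounds(1,2) by (intro mult_left_mono) auto
        then show "- (2 * t) \<le> (1 + t) * - t" by (simp add: algebra_simps)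
      qed
      also have "\<dots> = (real u powr (1 + t)) powr (- t)" by (simp add: powr_powr)
      also have "\<dots> \<le> real (g * n0) powr (- t)"
        using partner_le[OF nn0(1)] near_basic(1,2)[OF g, of n0] n0 T t_bounds(1)
        by (intro powr_mono2') auto
      also have "\<dots> \<le> w (g * n0)" using nn0(1) by (simp add: partner_def)
      also have "\<dots> \<le> (1/2) ^ j" using j[OF n0] by simp
      finally show ?thesis using u_gt_1 by (simp add: powr_minus power_one_over field_simps)
    qed
    \<comment> \<open>Factors 2 are absorbed into one more factor \<open>u powr t\<close>.\<close>
    have z2: "2 * real u powr a \<le> real u powr (a + t)" for a
    proof -
      have "2 * real u powr a \<le> real u powr t * real u powr a"
        using large_12 by (intro mult_right_mono) auto
      then show ?thesis by (simp add: powr_add mult.commute)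
    qed
    have XU: "real u powr (1 - 9 * t) \<le> XU"
    proof -
      have "real u powr (1 - 9 * t) * 2 \<le> real u powr (1 - 8 * t)" using z2[of "1 - 9 * t"] by simp
      also have "\<dots> = real u powr (- t) * real u powr 1 / real u powr (7 * t)"
        unfolding powr_add[symmetric] powr_diff[symmetric] by simp
      also have "\<dots> \<le> real u powr (- t) * real u / g"
        using small u_gt_1 g0 by (auto intro!: divide_left_mono)
      finally have "real u powr (1 - 9 * t) \<le> real u powr (- t) / 2 * real u / g" by simp
      also have "\<dots> \<le> x * real u / g" using x_ge by (intro divide_right_mono mult_right_mono) auto
      finally show ?thesis by (simp add: XU_def)
    qed
    have "1 \<le> real u powr (1 - 9 * t)" using u_gt_1 t_bounds(1,2) by (intro ge_one_powr_ge_zero) auto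
    then have XU1: "1 \<le> XU" using XU by linarith
    \<comment> \<open>The largest tolerance on \<gamma> within the class, from v \<ge> x u, ln v
      \<ge> Y / 2 and w v \<ge> 2^-(j+1). The moduli \<open>M\<^sub>1\<close> and
      \<open>M\<^sub>2\<close> below are the inverse tolerances over 12; adding 1 after the floor
      keeps them positive, and only \<open>M\<^sub>1 - 1\<close> and \<open>M\<^sub>2 - 1\<close>
      enter the phase conditions.\<close>
    define \<Delta> where "\<Delta> = 8 * C * 2 ^ j / (g * Y * x)"
    have \<Delta>0: "\<Delta> > 0" using C Y g0 x by (simp add: \<Delta>_def)
    define M\<^sub>1 where "M\<^sub>1 = nat \<lfloor>1 / (12 * \<Delta>)\<rfloor> + 1"
    define M\<^sub>2 :: nat where "M\<^sub>2 = nat \<lfloor>2 ^ j / 12 :: real\<rfloor> + 1"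
    have nonneg: "0 \<le> 1 / (12 * \<Delta>)" "0 \<le> (2 ^ j / 12 :: real)" using \<Delta>0 by auto
    have M1: "1 \<le> M\<^sub>1" "1 / (12 * \<Delta>) \<le> real M\<^sub>1" "real M\<^sub>1 \<le> 1 / (12 * \<Delta>) + 1" "real (M\<^sub>1 - 1) \<le> 1 / (12 * \<Delta>)"
      using nonneg unfolding M\<^sub>1_def by linarith+
    have M2: "1 \<le> M\<^sub>2" "2 ^ j / 12 \<le> real M\<^sub>2" "real M\<^sub>2 \<le> 2 ^ j / 12 + 1" "real (M\<^sub>2 - 1) \<le> 2 ^ j / 12"
      using nonneg unfolding M\<^sub>2_def by linarith+
    define N where "N = nat \<lfloor>2 * XU\<rfloor> + 1"
    have N: "real N \<le> 3 * XU" using XU1 unfolding N_def by linarith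
    have one_le: "1 \<le> real u powr a" if "0 \<le> a" for a using that u_gt_1 by (intro ge_one_powr_ge_zero) auto
    have M1_le: "real M\<^sub>1 \<le> real u powr (10 * t)"
    proof -
      have "1 / (12 * \<Delta>) = (g * Y * x) / (96 * C * 2 ^ j)" using C Y g0 x by (simp add: \<Delta>_def field_simps)
      also have "\<dots> \<le> (g * Y * x) / 1"
      proof (rule divide_left_mono)
        have "1 * 1 \<le> (96 * C) * (2::real) ^ j" using C by (intro mult_mono) auto
        then show "1 \<le> 96 * C * (2::real) ^ j" by simp
      qed (use C Y g0 x in auto)
      also have "\<dots> \<le> real u powr (7 * t) * real u powr t * real u powr t"
        using small large_ln x_le Y x by (auto simp: Y_def intro!: mult_mono)
      also have "\<dots> = real u powr (9 * t)" by (simp flip: powr_add)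
      finally have "real M\<^sub>1 \<le> 2 * real u powr (9 * t)" using M1(3) one_le[of "9 * t"] t_bounds(1) by linarith
      then show ?thesis using z2[of "9 * t"] by simp
    qed
    have M2_le: "real M\<^sub>2 \<le> 2 * real u powr (2 * t)"
      using M2(3) j_le one_le[of "2 * t"] t_bounds(1) by simp
    have gM2_le: "real (g * M\<^sub>2) \<le> real u powr (10 * t)"
    proof -
      have "real (g * M\<^sub>2) \<le> real u powr (7 * t) * (2 * real u powr (2 * t))"
        using small M2_le by (auto intro!: mult_mono)
      also have "\<dots> = 2 * real u powr (9 * t)" by (simp flip: powr_add)
      finally show ?thesis using z2[of "9 * t"] by simp
    qed
    have M12: "real M\<^sub>1 * real M\<^sub>2 \<le> real u powr (13 * t)"
    proof -
      have "real M\<^sub>1 * real M\<^sub>2 \<le> real u powr (10 * t) * (2 * real u powr (2 * t))"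
        using M1_le M2_le by (intro mult_mono) auto
      also have "\<dots> = 2 * real u powr (12 * t)" by (simp flip: powr_add)
      finally show ?thesis using z2[of "12 * t"] by simp
    qed
    have M12pos: "0 < real M\<^sub>1 * real M\<^sub>2" using M1 M2 by simp
    \<comment> \<open>The sieve error is dominated by the main term: it is at most
      \<open>u powr (10 * t * R + t)\<close>, while the main term is at least
      \<open>u powr (1 - 22 * t)\<close>, and all losses together are at most 33/40.\<close>
    have K_le: "real (max M\<^sub>1 (g * M\<^sub>2)) powr R / c \<le> XU / (real M\<^sub>1 * real M\<^sub>2)"
    proof -
      have "real (max M\<^sub>1 (g * M\<^sub>2)) \<le> real u powr (10 * t)"
        using M1_le gM2_le by (simp add: max_def del: of_nat_mult)
      then have "real (max M\<^sub>1 (g * M\<^sub>2)) powr R \<le> (real u powr (10 * t)) powr R"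
        using R_ge_1 by (intro powr_mono2) auto
      also have "\<dots> = real u powr (10 * t * R)" by (simp add: powr_powr)
      finally have "real (max M\<^sub>1 (g * M\<^sub>2)) powr R / c \<le> real u powr (10 * t * R) * (1 / c)"
        using c_pos by (simp add: divide_right_mono)
      also have "\<dots> \<le> real u powr (10 * t * R) * real u powr t" using large_c by (intro mult_left_mono) auto
      also have "\<dots> = real u powr (10 * t * R + t)" by (simp flip: powr_add)
      also have "\<dots> \<le> real u powr (1 - 9 * t - 13 * t)" using t_bounds by (intro u_powr_mono) linarith
      also have "\<dots> = real u powr (1 - 9 * t) / real u powr (13 * t)" by (simp flip: powr_diff)
      also have "\<dots> \<le> XU / (real M\<^sub>1 * real M\<^sub>2)" using XU M12 M12pos XU1 by (intro frac_le) auto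
      finally show ?thesis .
    qed
    have "real (card T) \<le> 4 * (real N / (real M\<^sub>1 * real M\<^sub>2) + real (max M\<^sub>1 (g * M\<^sub>2)) powr R / c)"
    proof (rule card_two_dim_bohr_le[OF dio])
      show "T \<subseteq> {0..<0 + N}"
      proof
        fix n assume "n \<in> T"
        then have "real n \<le> 2 * XU" using x(2)[of n] g0 u_gt_1 by (simp add: XU_def field_simps)
        then show "n \<in> {0..<0 + N}" by (simp add: N_def less_Suc_eq_le le_nat_floor)
      qed
    next
      fix n assume n: "n \<in> T"
      then have nn: "n \<in> near g" using T by auto
      define v where "v = g * n"
      have p: "partner v" "real u powr (1 - t) \<le> real v" using nn by (auto simp: near_def v_def)
      have v0: "real v > 0" using p(1) by (simp add: partner_def)
      have v3: "v \<ge> 3" using p(1) by (simp add: partner_def)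
      have lnv: "Y / 2 \<le> ln (real v)" using ln_ge_half[OF p(2)] by (simp add: Y_def)
      have wv: "(1/2) ^ Suc j \<le> w v" using j[OF n] by (simp add: v_def)
      have xv: "x * u \<le> real v" using x(2)[OF n] u_gt_1 by (simp add: v_def field_simps)
      have "\<delta> v \<le> C / (real v * ln (real v) * w v)" using p by (simp add: partner_def)
      also have "\<dots> \<le> C / ((x * u) * (Y / 2) * (1/2) ^ Suc j)"
        using xv lnv wv x(1) u_gt_1 Y C partner_w(1)[OF p(1)] v0 v3
        by (intro divide_left_mono mult_mono mult_pos_pos) auto
      also have "\<dots> = 4 * C * 2 ^ j / (x * u * Y)" by (simp add: power_one_over field_simps)
      finally have "2 * real u * \<delta> v / g \<le> 2 * real u * (4 * C * 2 ^ j / (x * u * Y)) / g"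
        using u_gt_1 by (intro divide_right_mono mult_left_mono) auto
      also have "\<dots> = \<Delta>" using u_gt_1 by (simp add: \<Delta>_def field_simps)
      finally have "int_dist (real n * \<gamma> + - (real (u div g) * \<gamma>)) \<le> \<Delta>"
        using near_basic(5)[OF g nn] by (simp add: v_def)
      then have "real (M\<^sub>1 - 1) * int_dist (real n * \<gamma> + - (real (u div g) * \<gamma>)) \<le> 1 / (12 * \<Delta>) * \<Delta>"
        using M1(4) \<Delta>0 by (intro mult_mono) auto
      then show "real (M\<^sub>1 - 1) * int_dist (real n * \<gamma> + - (real (u div g) * \<gamma>)) \<le> 1/12"
        using \<Delta>0 by simp
      have eq: "real n * real g * \<beta> + - \<gamma>' = real v * \<beta> - \<gamma>'" by (simp add: v_def mult_ac)
      have "real (M\<^sub>2 - 1) * w v \<le> 2 ^ j / 12 * (1/2) ^ j"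
        using M2(4) j[OF n] partner_w(1)[OF p(1)] by (intro mult_mono) (auto simp: v_def)
      also have "\<dots> = 1/12" by (simp add: power_one_over)
      finally show "real (M\<^sub>2 - 1) * int_dist (real n * real g * \<beta> + - \<gamma>') \<le> 1/12"
        unfolding eq by (simp add: w_def)
    qed (use M1 M2 g0 in auto)
    also have "\<dots> \<le> 4 * (3 * XU / (real M\<^sub>1 * real M\<^sub>2) + XU / (real M\<^sub>1 * real M\<^sub>2))"
      using N K_le by (intro mult_left_mono add_mono divide_right_mono) auto
    also have "\<dots> = 16 * XU / (real M\<^sub>1 * real M\<^sub>2)" by (simp add: field_simps)
    finally have main: "real (card T) \<le> 16 * XU / (real M\<^sub>1 * real M\<^sub>2)" .
    have "16 * XU / (real M\<^sub>1 * real M\<^sub>2) \<le> 16 * XU / (1 * (2 ^ j / 12))"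
      using M1 M2 XU1 by (intro divide_left_mono mult_mono mult_pos_pos) auto
    also have "\<dots> = 192 * 1 * (real u / g) * (x / 2 ^ j)" by (simp add: XU_def field_simps)
    also have "\<dots> \<le> 18432 * C * (real u / g) * (x / 2 ^ j)"
      using C x by (intro mult_right_mono mult_mono) auto
    finally have "real (card T) \<le> 18432 * C * (real u / g) * (x / 2 ^ j)" using main by linarith
    moreover have "16 * XU / (real M\<^sub>1 * real M\<^sub>2) \<le> 16 * XU / (1 / (12 * \<Delta>) * (2 ^ j / 12))"
      using M1 M2 XU1 \<Delta>0 by (intro divide_left_mono mult_mono mult_pos_pos) auto
    moreover have "16 * XU / (1 / (12 * \<Delta>) * (2 ^ j / 12)) = 18432 * C * (real u / g) * (1 / (g * Y))"
      using C x Y g0 by (simp add: XU_def \<Delta>_def field_simps)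
    ultimately show ?thesis using main by linarith
  qed
  then show "real (card T) \<le> 18432 * C * (real u / g) * (x / 2 ^ j)"
    and "real (card T) \<le> 18432 * C * (real u / g) * (1 / (g * ln (real u)))"
    by (auto simp: Y_def)
qed

text \<open>The class of \<open>n\<close> is given by \<open>j\<close> and \<open>l\<close> with \<open>w (g * n)\<close> about \<open>2\<^sup>-\<^sup>j\<close> and \<open>g * n / u\<close> about
  \<open>2 powr ((j + b - l) / 2)\<close>. The lower bound on \<open>\<delta>\<close> forces \<open>l \<ge> 0\<close>, so interpolating between the two
  bounds for a class with exponent \<open>\<theta>\<close> yields a geometric series in both \<open>j\<close> and \<open>l\<close>.\<close>
lemma card_near_small_divisor:
  fixes g :: nat
  defines "\<theta> \<equiv> 1 / (5 * ln (ln (real u)))"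
  assumes g: "g dvd u" and small: "real g \<le> real u powr (7 * t)" and T: "T \<subseteq> near g" "finite T"
  shows "real g * real (card T) \<le>
    18432 * C * (16 * C) * 3200 * real u * ((ln (ln (real u)))\<^sup>2 / ln (real u) * real g powr (\<theta> - 1))"
proof -
  define Y where "Y = ln (real u)"
  have Y: "Y \<ge> 3" using ln_ge_3 by (simp add: Y_def)
  have lnY: "ln Y \<ge> 1"
  proof -
    have "exp 1 \<le> Y" using Y exp_le by linarith
    then show ?thesis using Y by (simp add: ln_ge_iff)
  qed
  \<comment> \<open>An exponent of order 1 / ln Y keeps \<open>Y powr \<theta>\<close> bounded,
    while the two geometric series cost only a multiple of (ln Y)^2.\<close>
  have \<theta>: "0 < \<theta>" "\<theta> \<le> 1/5" using lnY by (auto simp: \<theta>_def Y_def[symmetric] field_simps)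
  have Y\<theta>: "Y powr \<theta> \<le> 2"
  proof -
    have "Y powr \<theta> = exp (1/5)" using Y lnY by (simp add: powr_def \<theta>_def Y_def[symmetric])
    also have "\<dots> \<le> 2"
    proof -
      have "1 - 1/5 \<le> exp (- (1/5) :: real)" using exp_ge_add_one_self[of "- (1/5) :: real"] by simp
      then show ?thesis by (simp add: exp_minus field_simps)
    qed
    finally show ?thesis .
  qed
  have g0: "g > 0" using g u_gt_1 by (auto intro: Nat.gr0I)
  define D where "D = 4 * C"
  have D: "D \<ge> 4" using C by (simp add: D_def)
  have DY: "1 \<le> D * Y" using mult_mono[of 1 D 1 Y] D Y by simp
  \<comment> \<open>\<open>2 powr b\<close> equals \<open>D * Y\<close> up to a factor 2. In
    \<open>D\<close>, the 4 comes from ln v \<ge> Y / 2 and from the width of a dyadic class of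
    \<open>w\<close>.\<close>
  define b where "b = nat \<lceil>log 2 (D * Y)\<rceil>"
  have "0 \<le> log 2 (D * Y)" using DY by simp
  then have b: "log 2 (D * Y) \<le> real b" "real b \<le> log 2 (D * Y) + 1" unfolding b_def by linarith+
  \<comment> \<open>As \<open>w\<close> is at most 1/2, the floor is nonnegative and
    \<open>nat\<close> loses nothing.\<close>
  define J where "J = (\<lambda>n. nat \<lfloor>- log 2 (w (g * n))\<rfloor>)"
  define k where "k = (\<lambda>n. \<lfloor>log 2 (real (g * n) / u)\<rfloor>)"
  define L where "L = (\<lambda>n. nat (int (J n) + int b - 2 * k n))"
  have class_J: "(1/2) ^ Suc (J n) < w (g * n) \<and> w (g * n) \<le> (1/2) ^ J n" if "n \<in> T" for n
  proof -
    have p: "partner (g * n)" using that T by (auto simp: near_def)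
    note w01 = partner_w(1)[OF p] partner_w(2)[of "g * n"]
    let ?l = "log 2 (w (g * n))"
    have "log 2 (w (g * n)) \<le> log 2 1" using w01 by (subst log_le_cancel_iff) auto
    then have l: "- real (J n) - 1 < ?l" "?l \<le> - real (J n)" unfolding J_def by simp_all linarith+
    have w_eq: "w (g * n) = 2 powr ?l" using w01 by simp
    have "2 powr (- real (J n) - 1) < w (g * n)" using l(1) by (subst w_eq) (intro powr_less_mono, auto)
    moreover have "w (g * n) \<le> 2 powr (- real (J n))" using l(2) by (subst w_eq) (intro powr_mono, auto)
    ultimately show ?thesis
      by (simp add: powr_diff powr_minus powr_realpow power_one_over inverse_eq_divide)
  qed
  have class_k: "2 powr k n \<le> real (g * n) / u \<and> real (g * n) / u < 2 * 2 powr k n" if "n \<in> T" for n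
  proof -
    have n0: "0 < real (g * n) / u" using near_basic(2)[OF g] that T g0 u_gt_1 by auto
    let ?l = "log 2 (real (g * n) / u)"
    have eq: "real (g * n) / u = 2 powr ?l" using n0 by simp
    have l: "real_of_int (k n) \<le> ?l" "?l < 1 + real_of_int (k n)" unfolding k_def by linarith+
    have "2 powr k n \<le> real (g * n) / u" using l(1) by (subst eq) (intro powr_mono, auto)
    moreover have "real (g * n) / u < 2 powr (1 + k n)" using l(2) by (subst eq) (intro powr_less_mono, auto)
    ultimately show ?thesis by (simp add: powr_add)
  qed
  \<comment> \<open>Comparing the lower bound 1 / (u^2 Y^2) for \<delta>(v) / v with its upper bound
    gives (v / u)^2 \<le> D Y 2^J, hence 2 k \<le> b + J. So \<open>nat\<close> in \<open>L\<close>
    does not truncate.\<close>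
  have L_eq: "real_of_int (k n) = (real (J n) + real b - real (L n)) / 2" if n: "n \<in> T" for n
  proof -
    define v where "v = g * n"
    have p: "partner v" "real u powr (1 - t) \<le> real v" using n T by (auto simp: near_def v_def)
    have v0: "real v > 0" using p(1) by (simp add: partner_def)
    have lnv: "Y / 2 \<le> ln (real v)" using ln_ge_half[OF p(2)] by (simp add: Y_def)
    have v3: "v \<ge> 3" using p(1) by (simp add: partner_def)
    have wJ: "(1/2) ^ Suc (J n) \<le> w v" using class_J[OF n] by (simp add: v_def)
    have "1 / ((real u)\<^sup>2 * Y\<^sup>2) \<le> \<delta> v / real v" using p by (simp add: partner_def Y_def)
    also have "\<dots> \<le> C / (real v * ln (real v) * w v) / real v"
      using p by (intro divide_right_mono) (auto simp: partner_def)
    also have "\<dots> \<le> C / (real v * (Y / 2) * (1/2) ^ Suc (J n)) / real v"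
      using lnv wJ Y C partner_w(1)[OF p(1)] v0 v3
      by (intro divide_right_mono divide_left_mono mult_mono mult_pos_pos) auto
    also have "\<dots> = D * 2 ^ J n / ((real v)\<^sup>2 * Y)"
      by (simp add: power_one_over field_simps D_def power2_eq_square)
    finally have "(real v)\<^sup>2 * Y \<le> D * 2 ^ J n * ((real u)\<^sup>2 * Y\<^sup>2)"
      using v0 u_gt_1 Y by (simp add: divide_le_eq le_divide_eq mult_ac split: if_splits)
    then have "Y * (real v)\<^sup>2 \<le> Y * (D * Y * 2 ^ J n * (real u)\<^sup>2)" by (simp add: power2_eq_square mult_ac)
    then have "(real v)\<^sup>2 \<le> D * Y * 2 ^ J n * (real u)\<^sup>2" using Y by simp
    then have "(real v / u)\<^sup>2 \<le> D * Y * 2 ^ J n" using u_gt_1 by (simp add: power_divide field_simps)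
    moreover have "(2 powr k n)\<^sup>2 \<le> (real v / u)\<^sup>2" using class_k[OF n] by (intro power_mono) (auto simp: v_def)
    moreover have "D * Y \<le> 2 powr b"
    proof -
      have "D * Y = 2 powr log 2 (D * Y)" using DY by simp
      also have "\<dots> \<le> 2 powr b" using b by (intro powr_mono) auto
      finally show ?thesis .
    qed
    moreover have "D * Y * 2 ^ J n \<le> 2 powr b * 2 ^ J n" using calculation(3) by (intro mult_right_mono) auto
    ultimately have "(2 powr k n)\<^sup>2 \<le> 2 powr b * 2 ^ J n" by linarith
    moreover have "(2 powr k n)\<^sup>2 = (2::real) powr (2 * real_of_int (k n))"
      unfolding power2_eq_square powr_add[symmetric] by simp
    moreover have "2 powr b * 2 ^ J n = (2::real) powr (real b + real (J n))"
      by (simp add: powr_add powr_realpow)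
    ultimately have "2 powr (2 * real_of_int (k n)) \<le> (2::real) powr (real b + real (J n))"
      by (simp only:)
    then have "2 * real_of_int (k n) \<le> real b + real (J n)" by simp
    then have "2 * k n \<le> int b + int (J n)" by linarith
    then have "int (L n) = int (J n) + int b - 2 * k n" by (simp add: L_def)
    then have "real (L n) = real (J n) + real b - 2 * real_of_int (k n)" by linarith
    then show ?thesis by simp
  qed
  obtain m where m: "\<And>n. n \<in> T \<Longrightarrow> J n \<le> m \<and> L n \<le> m"
  proof -
    have "finite (J ` T \<union> L ` T)" using T by simp
    then obtain m where "\<forall>i\<in>J ` T \<union> L ` T. i \<le> m" using finite_nat_set_iff_bounded_le by blast
    then show thesis using that by blast
  qed
  define Tc where "Tc = (\<lambda>(j,l). {n\<in>T. J n = j \<and> L n = l})"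
  define q where "q = 2 powr (- (\<theta> / 2))"
  have qpow: "q ^ i = 2 powr (- (\<theta> / 2) * real i)" for i
  proof -
    have "q ^ i = q powr real i" by (simp add: q_def powr_realpow)
    also have "\<dots> = 2 powr (- (\<theta> / 2) * real i)" unfolding q_def by (rule powr_powr)
    finally show ?thesis .
  qed
  define A where "A = 18432 * C * (real u / g)"
  have A: "A > 0" using C u_gt_1 g0 by (simp add: A_def)
  have card_Tc: "real (card (Tc (j,l))) \<le> A * (2 powr (\<theta> * b / 2) * (g * Y) powr (\<theta> - 1)) * (q ^ j * q ^ l)" for j l
  proof -
    define x where "x = 2 powr ((real j + real b - real l) / 2)"
    have x0: "x > 0" by (simp add: x_def)
    have sub: "Tc (j,l) \<subseteq> near g" using T by (auto simp: Tc_def)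
    have xc: "x \<le> real (g * n) / u \<and> real (g * n) / u < 2 * x" if "n \<in> Tc (j,l)" for n
    proof -
      have n: "n \<in> T" "J n = j" "L n = l" using that by (auto simp: Tc_def)
      have "x = 2 powr k n" by (simp only: x_def L_eq[OF n(1)] n(2,3))
      then show ?thesis using class_k[OF n(1)] by simp
    qed
    have jc: "(1/2) ^ Suc j < w (g * n) \<and> w (g * n) \<le> (1/2) ^ j" if "n \<in> Tc (j,l)" for n
      using class_J[of n] that by (auto simp: Tc_def)
    note c2 = card_near_class[OF g small sub x0 xc jc]
    \<comment> \<open>The first bound, raised to \<theta>, supplies the decay in \<open>j\<close>
      and \<open>l\<close>; the second, raised to 1 - \<theta>, supplies the size.\<close>
    have "real (card (Tc (j,l))) / A \<le> (x / 2 ^ j) powr \<theta> * (1 / (g * Y)) powr (1 - \<theta>)"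
    proof (rule min_le_geometric_mean)
      show "real (card (Tc (j,l))) / A \<le> x / 2 ^ j"
        using c2(1) A unfolding A_def[symmetric] by (simp add: pos_divide_le_eq mult.commute)
      show "real (card (Tc (j,l))) / A \<le> 1 / (g * Y)"
        using c2(2) A unfolding A_def[symmetric] Y_def[symmetric] by (simp add: pos_divide_le_eq mult.commute)
    qed (use x0 g0 Y \<theta> A in auto)
    also have "(1 / (g * Y)) powr (1 - \<theta>) = (g * Y) powr (\<theta> - 1)"
      using g0 Y by (simp add: powr_divide powr_minus_divide[symmetric])
    also have "(x / 2 ^ j) powr \<theta> = (2 powr ((real b - real j - real l) / 2)) powr \<theta>"
    proof -
      have "x / 2 ^ j = 2 powr ((real j + real b - real l) / 2 - real j)"
        by (simp add: x_def powr_diff powr_realpow)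
      also have "(real j + real b - real l) / 2 - real j = (real b - real j - real l) / 2" by (simp add: field_simps)
      finally show ?thesis by simp
    qed
    also have "\<dots> = 2 powr (\<theta> * b / 2 + - (\<theta> / 2) * real j + - (\<theta> / 2) * real l)"
    proof -
      have "(real b - real j - real l) / 2 * \<theta> = \<theta> * b / 2 + - (\<theta> / 2) * real j + - (\<theta> / 2) * real l"
        by (simp add: algebra_simps diff_divide_distrib add_divide_distrib)
      then show ?thesis by (simp only: powr_powr)
    qed
    also have "\<dots> = 2 powr (\<theta> * b / 2) * (q ^ j * q ^ l)"
      by (simp only: qpow powr_add mult.assoc)
    finally show ?thesis using A by (simp add: pos_divide_le_eq mult_ac)
  qed
  have "T \<subseteq> (\<Union>p\<in>{..m} \<times> {..m}. Tc p)" using m by (auto simp: Tc_def)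
  then have "card T \<le> card (\<Union>p\<in>{..m} \<times> {..m}. Tc p)"
    using T by (intro card_mono) (auto simp: Tc_def)
  also have "\<dots> \<le> (\<Sum>p\<in>{..m} \<times> {..m}. card (Tc p))" by (intro card_UN_le) auto
  finally have "real (card T) \<le> (\<Sum>p\<in>{..m} \<times> {..m}. real (card (Tc p)))"
    by (simp flip: of_nat_sum)
  also have "\<dots> \<le> (\<Sum>(j,l)\<in>{..m} \<times> {..m}. A * (2 powr (\<theta> * b / 2) * (g * Y) powr (\<theta> - 1)) * (q ^ j * q ^ l))"
    using card_Tc by (intro sum_mono) auto
  also have "\<dots> = A * (2 powr (\<theta> * b / 2) * (g * Y) powr (\<theta> - 1)) * ((\<Sum>j\<le>m. q ^ j) * (\<Sum>l\<le>m. q ^ l))"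
    by (subst sum_product, subst sum.cartesian_product, subst sum_distrib_left) (simp add: case_prod_unfold)
  also have "\<dots> \<le> A * ((16 * C) * (2 * real g powr (\<theta> - 1) / Y)) * ((40 * ln Y) * (40 * ln Y))"
  proof (intro mult_mono)
    have "2 powr (\<theta> * b / 2) \<le> (2 powr b) powr \<theta>"
      unfolding powr_powr using \<theta> by (intro powr_mono) (auto simp: mult_ac)
    also have "2 powr b \<le> 2 * (D * Y)"
    proof -
      have "2 powr b \<le> 2 powr (log 2 (D * Y) + 1)" using b by (intro powr_mono) auto
      then show ?thesis using DY by (simp add: powr_add)
    qed
    then have "(2 powr b) powr \<theta> \<le> (2 * (D * Y)) powr \<theta>" using \<theta> by (intro powr_mono2) auto
    also have "\<dots> = (2 * D) powr \<theta> * Y powr \<theta>" using D Y by (simp add: powr_mult[symmetric] mult_ac)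
    also have "\<dots> \<le> (2 * D) powr 1 * 2"
      using D \<theta> Y\<theta> by (intro mult_mono powr_mono) auto
    also have "\<dots> = 16 * C" using D by (simp add: D_def)
    finally show "2 powr (\<theta> * b / 2) \<le> 16 * C" .
    have "(g * Y) powr (\<theta> - 1) = real g powr (\<theta> - 1) * (Y powr \<theta> / Y)"
      using g0 Y by (simp add: powr_mult powr_diff)
    also have "\<dots> \<le> real g powr (\<theta> - 1) * (2 / Y)"
      using Y\<theta> Y by (intro mult_left_mono divide_right_mono) auto
    finally show "(g * Y) powr (\<theta> - 1) \<le> 2 * real g powr (\<theta> - 1) / Y" by (simp add: mult_ac)
    \<comment> \<open>The ratio is exp (-y) with y of order \<theta>, so each series is at most 8 /
      \<theta> = 40 ln Y.\<close>
    have q: "0 \<le> q" "1 - q \<ge> \<theta> / 8"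
    proof -
      show "0 \<le> q" by (simp add: q_def)
      define y where "y = \<theta> * ln 2 / 2"
      have "ln 2 \<ge> (1/2 :: real)" using ln2_ge_two_thirds by simp
      then have "\<theta> * (1/2) \<le> \<theta> * ln 2" using \<theta> by (intro mult_left_mono) auto
      then have y1: "\<theta> / 4 \<le> y" by (simp add: y_def)
      have "ln 2 \<le> (1 :: real)" using ln_2_less_1 by simp
      then have "\<theta> * ln 2 \<le> \<theta> * 1" using \<theta> by (intro mult_left_mono) auto
      then have "\<theta> * ln 2 \<le> 1" using \<theta> by linarith
      then have y2: "y \<le> 1" unfolding y_def by linarith
      have y0: "0 \<le> y" using y1 \<theta> by linarith
      have "q = exp (- y)" by (simp add: q_def powr_def y_def)
      also have "\<dots> \<le> 1 / (1 + y)"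
        using exp_ge_add_one_self[of y] y0 by (simp add: exp_minus field_simps)
      also have "\<dots> \<le> 1 - y / 2"
      proof -
        have "y * y \<le> y * 1" using y0 y2 by (intro mult_left_mono) auto
        then have "1 \<le> (1 - y / 2) * (1 + y)" by (simp add: algebra_simps)
        then show ?thesis using y0 by (simp add: pos_divide_le_eq)
      qed
      finally show "1 - q \<ge> \<theta> / 8" using y1 by linarith
    qed
    have "q < 1" using q(2) \<theta> by linarith
    then have "(\<Sum>j\<le>m. q ^ j) \<le> 1 / (1 - q)" using q by (intro sum_power_le_geometric) auto
    also have "\<dots> \<le> 1 / (\<theta> / 8)" using q \<theta> \<open>q < 1\<close> by (intro divide_left_mono) auto
    also have "\<dots> = 40 * ln Y" using lnY by (simp add: \<theta>_def Y_def[symmetric])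
    finally show "(\<Sum>j\<le>m. q ^ j) \<le> 40 * ln Y" "(\<Sum>j\<le>m. q ^ j) \<le> 40 * ln Y" by auto
  qed (use A C Y lnY g0 in \<open>auto intro!: sum_nonneg simp: q_def\<close>)
  finally have "real g * real (card T) \<le>
      real g * (A * ((16 * C) * (2 * real g powr (\<theta> - 1) / Y)) * ((40 * ln Y) * (40 * ln Y)))"
    by (rule mult_left_mono) simp
  also have "\<dots> = 18432 * C * (16 * C) * 3200 * real u * ((ln Y)\<^sup>2 / Y * real g powr (\<theta> - 1))"
    using g0 by (simp add: A_def power2_eq_square)
  finally show ?thesis by (simp add: Y_def)
qed

section \<open>Total weight of the partners\<close>

text \<open>Partners below \<open>u powr (1 - t)\<close> and large divisors cost
  \<open>u powr (1 - t)\<close> per divisor, up to a constant, which the divisor bound turns into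
  O(u). Small divisors leave u (ln Y)^2 / Y times the divisor sum with exponent \<theta> - 1, again
  O(u).\<close>

lemma sum_gcd_partners_le:
  fixes C\<^sub>1 C\<^sub>2 :: real
  assumes V: "finite V" "\<And>v. v \<in> V \<Longrightarrow> partner v"
    and C1: "real (card {d. d dvd u}) \<le> C\<^sub>1 * real u powr t"
    and C2: "(\<Sum>d | d dvd u. real d powr (1 / (5 * ln (ln (real u))) - 1)) \<le> C\<^sub>2 * ln (real u) powr (5/8)"
  shows "(\<Sum>v\<in>V. real (gcd u v)) \<le>
    (C\<^sub>1 + (8 + 4 * 2 powr R / c) * C\<^sub>1 + 18432 * C * (16 * C) * 3200 * ((16/3)\<^sup>2 * C\<^sub>2)) * real u"
proof -
  define Y where "Y = ln (real u)"
  have Y: "Y \<ge> 3" using ln_ge_3 by (simp add: Y_def)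
  define A where "A = {v\<in>V. real v < real u powr (1 - t)}"
  define B where "B = {v\<in>V. real u powr (1 - t) \<le> real v}"
  define E where "E = 8 + 4 * 2 powr R / c"
  define K where "K = 18432 * C * (16 * C) * 3200"
  have E: "E \<ge> 0" using c_pos by (simp add: E_def)
  have K: "K \<ge> 0" using C by (simp add: K_def)
  have tau: "real (card {d. d dvd u}) * real u powr (1 - t) \<le> C\<^sub>1 * real u"
  proof -
    have "real (card {d. d dvd u}) * real u powr (1 - t) \<le> C\<^sub>1 * real u powr t * real u powr (1 - t)"
      using C1 by (intro mult_right_mono) auto
    also have "\<dots> = C\<^sub>1 * real u" using u_gt_1 by (simp flip: powr_add)
    finally show ?thesis .
  qed
  have "(\<Sum>v\<in>A. real (gcd u v)) \<le> (\<Sum>g | g dvd u. real u powr (1 - t))"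
  proof (rule sum_gcd_le_sum_divisors)
    fix g assume "g dvd u"
    then have "real g * real (card {v\<in>A. gcd u v = g}) \<le> real u powr (1 - t) \<or> real u powr (1 - t) < 0"
    proof (rule card_gcd_eq_le[rotated])
      fix v assume "v \<in> A"
      then have "partner v" "real v < real u powr (1 - t)" using V by (auto simp: A_def)
      then show "v > 0 \<and> real v \<le> real u powr (1 - t)" by (simp add: partner_def)
    qed (use V in \<open>auto simp: A_def\<close>)
    then show "real g * real (card {v\<in>A. gcd u v = g}) \<le> real u powr (1 - t)"
      using powr_ge_zero[of "real u" "1 - t"] by linarith
  qed (use V u_gt_1 in \<open>auto simp: A_def\<close>)
  also have "\<dots> \<le> C\<^sub>1 * real u" using tau by simp
  finally have sum_A: "(\<Sum>v\<in>A. real (gcd u v)) \<le> C\<^sub>1 * real u" .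
  let ?\<theta> = "1 / (5 * ln (ln (real u)))"
  have "(\<Sum>v\<in>B. real (gcd u v)) \<le>
      (\<Sum>g | g dvd u. E * real u powr (1 - t) + K * real u * ((ln Y)\<^sup>2 / Y * real g powr (?\<theta> - 1)))"
  proof (rule sum_gcd_le_sum_divisors)
    fix g assume g: "g dvd u"
    obtain T where T: "T \<subseteq> near g" "finite T" "card {v\<in>B. gcd u v = g} = card T"
      by (rule card_near[OF _ _ g, of B]) (use V in \<open>auto simp: B_def\<close>)
    have pos: "0 \<le> E * real u powr (1 - t)" "0 \<le> K * real u * ((ln Y)\<^sup>2 / Y * real g powr (?\<theta> - 1))"
      using E K Y by auto
    show "real g * real (card {v\<in>B. gcd u v = g}) \<le>
        E * real u powr (1 - t) + K * real u * ((ln Y)\<^sup>2 / Y * real g powr (?\<theta> - 1))"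
    proof (cases "real g \<le> real u powr (7 * t)")
      case True
      then show ?thesis
        using card_near_small_divisor[OF g True T(1,2)] pos T(3) by (simp add: Y_def K_def)
    next
      case False
      then show ?thesis
        using card_near_large_divisor[OF g _ T(1)] pos T(3) unfolding E_def by fastforce
    qed
  qed (use V u_gt_1 in \<open>auto simp: B_def\<close>)
  also have "\<dots> = E * (real (card {d. d dvd u}) * real u powr (1 - t))
      + K * real u * ((ln Y)\<^sup>2 / Y * (\<Sum>d | d dvd u. real d powr (?\<theta> - 1)))"
    by (simp add: sum.distrib sum_distrib_left mult_ac)
  also have "\<dots> \<le> E * (C\<^sub>1 * real u) + K * real u * ((16/3)\<^sup>2 * C\<^sub>2)"
  proof (intro add_mono mult_left_mono tau)
    have S0: "0 \<le> (\<Sum>d | d dvd u. real d powr (?\<theta> - 1))" by (intro sum_nonneg) auto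
    have lnY: "ln Y \<ge> 0" using Y by simp
    \<comment> \<open>The exponent is chosen so that its double, 3/8, and the 5/8 of the divisor sum
      add up to 1.\<close>
    have "ln Y \<le> Y powr (3/16) / (3/16)" using Y by (intro ln_powr_bound) auto
    then have "(ln Y)\<^sup>2 \<le> (Y powr (3/16) * (16/3))\<^sup>2" using lnY by (intro power_mono) auto
    also have "\<dots> = (16/3)\<^sup>2 * Y powr (3/8)"
      by (simp add: power2_eq_square powr_add[symmetric] mult_ac)
    finally have "(ln Y)\<^sup>2 / Y * (\<Sum>d | d dvd u. real d powr (?\<theta> - 1))
        \<le> ((16/3)\<^sup>2 * Y powr (3/8)) / Y * (C\<^sub>2 * Y powr (5/8))"
      using C2 Y S0 by (intro mult_mono divide_right_mono) (auto simp: Y_def)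
    also have "\<dots> = (16/3)\<^sup>2 * C\<^sub>2 * (Y powr (3/8 + 5/8) / Y)"
      unfolding powr_add by (simp add: field_simps)
    also have "\<dots> = (16/3)\<^sup>2 * C\<^sub>2" using Y by simp
    finally show "(ln Y)\<^sup>2 / Y * (\<Sum>d | d dvd u. real d powr (?\<theta> - 1)) \<le> (16/3)\<^sup>2 * C\<^sub>2" .
  qed (use E K in auto)
  finally have sum_B: "(\<Sum>v\<in>B. real (gcd u v)) \<le> E * (C\<^sub>1 * real u) + K * real u * ((16/3)\<^sup>2 * C\<^sub>2)" .
  have "(\<Sum>v\<in>V. real (gcd u v)) = (\<Sum>v\<in>A. real (gcd u v)) + (\<Sum>v\<in>B. real (gcd u v))"
  proof -
    have "sum f (A \<union> B) = sum f A + sum f B" for f :: "nat \<Rightarrow> real"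
      by (rule sum.union_disjoint) (use V in \<open>auto simp: A_def B_def\<close>)
    moreover have "V = A \<union> B" by (auto simp: A_def B_def)
    ultimately show ?thesis by metis
  qed
  then show ?thesis using sum_A sum_B by (simp add: E_def K_def algebra_simps)
qed

end

section \<open>Full measure\<close>

text \<open>Raising the exponent to at least 1 only weakens the bound, because the maximum of the
  coefficients is at least 1.\<close>

lemma diophantine_pair_imp_diophantine_with:
  assumes "diophantine_pair \<gamma> \<beta>"
  obtains c R where "diophantine_with c R \<gamma> \<beta>"
proof -
  obtain \<rho> c where \<rho>: "\<rho> > 0" "c > 0" and
    le: "\<And>m n :: int. (m, n) \<noteq> (0, 0) \<Longrightarrow>
      c * of_int (max \<bar>m\<bar> \<bar>n\<bar>) powr (- \<rho>) \<le> int_dist (of_int m * \<gamma> + of_int n * \<beta>)"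
    using assms unfolding diophantine_pair_def by blast
  have "diophantine_with c (max \<rho> 1) \<gamma> \<beta>"
    unfolding diophantine_with_def
  proof (intro conjI allI impI)
    fix m n :: int assume mn: "(m, n) \<noteq> (0, 0)"
    let ?M = "real_of_int (max \<bar>m\<bar> \<bar>n\<bar>)"
    have "?M \<ge> 1" using mn by auto
    then have "?M powr (- max \<rho> 1) \<le> ?M powr (- \<rho>)" by (intro powr_mono) auto
    then have "c * ?M powr (- max \<rho> 1) \<le> c * ?M powr (- \<rho>)" using \<rho> by (intro mult_left_mono) auto
    with le[OF mn] show "c * ?M powr (- max \<rho> 1) \<le> int_dist (of_int m * \<gamma> + of_int n * \<beta>)" by linarith
  qed (use \<rho> in auto)
  then show thesis by (rule that)
qed

text \<open>Comparison with the telescoping series of 1 / ln a - 1 / ln (a + 1), using 1 / (a + 1)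
  \<le> ln (a + 1) - ln a.\<close>

lemma summable_inverse_mult_ln_square:
  "summable (\<lambda>n. 1 / (real n * (ln (real n))\<^sup>2))"
proof -
  define f where "f = (\<lambda>n::nat. 1 / ln (real (n + 2)))"
  have "f \<longlonglongrightarrow> 0" unfolding f_def by real_asymp
  then have "summable (\<lambda>n. f n - f (Suc n))" by (rule telescope_summable')
  then have "summable (\<lambda>n. 1 / (real (n + 3) * (ln (real (n + 3)))\<^sup>2))"
  proof (rule summable_comparison_test_ev[rotated], intro always_eventually allI)
    fix n :: nat
    define a where "a = real (n + 2)"
    have a: "a \<ge> 2" "real (n + 3) = a + 1" by (simp_all add: a_def)
    have l: "0 < ln a" "ln a \<le> ln (a + 1)" using a by auto
    have "ln (a / (a + 1)) \<le> a / (a + 1) - 1" using a by (intro ln_le_minus_one) auto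
    also have "\<dots> = - (1 / (a + 1))" using a by (simp add: field_simps)
    finally have d: "1 / (a + 1) \<le> ln (a + 1) - ln a" using a by (simp add: ln_div)
    have "1 / ((a + 1) * (ln (a + 1))\<^sup>2) = (1 / (a + 1)) / (ln (a + 1) * ln (a + 1))"
      by (simp add: power2_eq_square)
    also have "\<dots> \<le> (ln (a + 1) - ln a) / (ln a * ln (a + 1))"
      using d l a by (intro frac_le mult_right_mono mult_pos_pos) auto
    also have "\<dots> = 1 / ln a - 1 / ln (a + 1)" using l by (simp add: field_simps)
    also have "\<dots> = f n - f (Suc n)" by (simp add: f_def a_def add_ac)
    finally show "norm (1 / (real (n + 3) * (ln (real (n + 3)))\<^sup>2)) \<le> f n - f (Suc n)"
      unfolding a(2) using a by simp
  qed
  then show ?thesis by (subst (asm) summable_iff_shift)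
qed

lemma eventually_large:
  fixes t C c :: real
  assumes t: "t > 0"
  shows "\<forall>\<^sub>F u::nat in sequentially. 2 * C \<le> real u powr t \<and> 12 \<le> real u powr t \<and> 1 / c \<le> real u powr t
    \<and> ln (real u) \<le> real u powr t \<and> C * (ln (real u))\<^sup>2 < real u powr (t / 2) \<and> 3 \<le> ln (real u)"
proof -
  have z: "filterlim (\<lambda>u::nat. real u powr t) at_top sequentially" using t by real_asymp
  then have ge: "\<forall>\<^sub>F u::nat in sequentially. B \<le> real u powr t" for B
    by (simp add: filterlim_at_top)
  have l: "\<forall>\<^sub>F u::nat in sequentially. ln (real u) \<le> real u powr t" using t by real_asymp
  have l3: "\<forall>\<^sub>F u::nat in sequentially. 3 \<le> ln (real u)" by real_asymp
  have "(\<lambda>u::nat. C * (ln (real u))\<^sup>2 / real u powr (t / 2)) \<longlonglongrightarrow> 0" using t by real_asymp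
  then have "\<forall>\<^sub>F u::nat in sequentially. C * (ln (real u))\<^sup>2 / real u powr (t / 2) < 1"
    by (rule order_tendstoD) simp
  then have l2: "\<forall>\<^sub>F u::nat in sequentially. C * (ln (real u))\<^sup>2 < real u powr (t / 2)"
    using eventually_gt_at_top[of 0] by eventually_elim (simp add: field_simps)
  show ?thesis by (intro eventually_conj ge l l2 l3)
qed

text \<open>Stated outside the locale, where \<open>u\<close> is fixed: \<open>K\<close> and
  \<open>U\<close> are chosen before \<gamma>', \<delta>, \<open>u\<close> and \<open>V\<close>, so
  the bound is uniform in them.\<close>

lemma sum_gcd_overlap_le:
  fixes c R C \<gamma> \<beta> :: real
  assumes dio: "diophantine_with c R \<gamma> \<beta>" and C: "C \<ge> 1"
  defines "t \<equiv> 1 / (40 * R\<^sup>2)"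
  shows "\<exists>K U. \<forall>\<gamma>' \<delta> u V. U \<le> u \<longrightarrow> finite V \<longrightarrow>
    (\<forall>v\<in>V. large_index.partner t C \<gamma> \<beta> \<gamma>' \<delta> u v) \<longrightarrow> (\<Sum>v\<in>V. real (gcd u v)) \<le> K * real u"
proof -
  have R: "R \<ge> 1" using dio by (simp add: diophantine_with_def)
  then have t: "t > 0" by (simp add: t_def)
  obtain U where U: "\<And>u::nat. u \<ge> U \<Longrightarrow> 2 * C \<le> real u powr t \<and> 12 \<le> real u powr t \<and> 1 / c \<le> real u powr t
    \<and> ln (real u) \<le> real u powr t \<and> C * (ln (real u))\<^sup>2 < real u powr (t / 2) \<and> 3 \<le> ln (real u)"
    using eventually_large[OF t, of C c] unfolding eventually_sequentially by blast
  obtain C\<^sub>1 where C1: "\<And>n::nat. n > 0 \<Longrightarrow> real (card {d. d dvd n}) \<le> C\<^sub>1 * real n powr t"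
    using card_divisors_le_powr[OF t] by blast
  obtain C\<^sub>2 where C2: "\<And>n::nat. 3 \<le> ln (real n) \<Longrightarrow>
     (\<Sum>d | d dvd n. real d powr (1 / (5 * ln (ln (real n))) - 1)) \<le> C\<^sub>2 * ln (real n) powr (5/8)"
    using sum_divisors_powr_near_minus_one by blast
  show ?thesis
  proof (intro exI allI impI)
    fix \<gamma>' \<delta> u V
    assume u: "U \<le> u" and V: "finite V" "\<forall>v\<in>V. large_index.partner t C \<gamma> \<beta> \<gamma>' \<delta> u v"
    interpret large_index c R t C \<gamma> \<beta> \<gamma>' \<delta> u
      by unfold_locales (use dio C U[OF u] in \<open>simp_all add: t_def\<close>)
    show "(\<Sum>v\<in>V. real (gcd u v)) \<le>
      (C\<^sub>1 + (8 + 4 * 2 powr R / c) * C\<^sub>1 + 18432 * C * (16 * C) * 3200 * ((16/3)\<^sup>2 * C\<^sub>2)) * real u"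
      using V C1 C2 u_gt_1(1) ln_ge_3 by (intro sum_gcd_partners_le) auto
  qed
qed

text \<open>From q = 4 on the iterated binary logarithm is at least 1, and the binary logarithm is
  at least the natural one.\<close>

lemma le_of_log2_bound:
  fixes \<psi> C :: real and q :: nat
  assumes q: "q \<ge> 4" and C: "C > 0"
    and le: "\<psi> \<le> C * (1 / (real q * log 2 (real q) * (log 2 (log 2 (real q)))\<^sup>2))"
  shows "\<psi> \<le> C / (real q * ln (real q))"
proof -
  have "log 2 4 \<le> log 2 (real q)" using q by (subst log_le_cancel_iff) auto
  moreover have "log 2 4 = (2 :: real)" using log_pow_cancel[of 2 2] by simp
  ultimately have l2: "2 \<le> log 2 (real q)" by simp
  then have "log 2 2 \<le> log 2 (log 2 (real q))" by (subst log_le_cancel_iff) auto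
  then have ll: "1 \<le> log 2 (log 2 (real q))" by simp
  have lnq: "ln (real q) > 0" using q by simp
  have "ln (real q) \<le> log 2 (real q)"
    using lnq ln_2_less_1 by (simp add: log_def le_divide_eq)
  moreover have "1 \<le> (log 2 (log 2 (real q)))\<^sup>2" using ll by (simp add: one_le_power)
  ultimately have "real q * ln (real q) * 1 \<le> real q * log 2 (real q) * (log 2 (log 2 (real q)))\<^sup>2"
    using lnq l2 by (intro mult_mono) auto
  then have "C / (real q * log 2 (real q) * (log 2 (log 2 (real q)))\<^sup>2) \<le> C / (real q * ln (real q))"
    using C lnq q by (intro divide_left_mono) (auto intro!: mult_pos_pos)
  then show ?thesis using le by simp
qed

text \<open>By completeness of Lebesgue measure, the part of \<open>W\<close> inside the null set is
  itself measurable and null. The endpoint 1 joins the null set because the covering concerns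
  \<open>{0..<1}\<close>.\<close>

lemma measure_eq_one_of_almost_all:
  fixes W :: "real set"
  assumes W: "W \<subseteq> {0..1}" and N: "N \<in> null_sets lborel" and sub: "{0..<1} - N \<subseteq> W"
  shows "measure lebesgue W = 1"
proof -
  define N' where "N' = insert 1 N"
  have "{1} \<in> null_sets (lborel :: real measure)" by (rule finite_imp_null_set_lborel) simp
  then have "N' \<in> null_sets lborel" using null_sets.Un[OF _ N] unfolding N'_def by force
  then have N': "N' \<in> null_sets lebesgue" by (rule null_sets_completionI)
  have null: "W \<inter> N' \<in> null_sets lebesgue"
    by (rule null_sets_completion_subset[OF _ N']) auto
  have eq: "W = ({0..1} - N') \<union> (W \<inter> N')" using W sub by (auto simp: N'_def less_le)
  have "emeasure lebesgue W = emeasure lebesgue ({0..1} - N')"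
    using null N' by (subst eq, subst emeasure_Un_null_set) auto
  also have "\<dots> = emeasure lebesgue {0..1::real}"
    using N' by (intro emeasure_Diff_null_set) auto
  also have "\<dots> = 1" by simp
  finally show ?thesis by (simp add: measure_def)
qed

theorem theorem1p5:
  fixes \<gamma> \<beta> :: real
  assumes "\<gamma> \<notin> \<rat>" and "\<beta> \<notin> \<rat>"
    and "diophantine_pair \<gamma> \<beta>"
  shows "\<exists>\<omega>\<^sub>0::real. \<omega>\<^sub>0 > 0 \<and>
    (\<forall>\<omega>. 0 < \<omega> \<and> \<omega> < \<omega>\<^sub>0 \<longrightarrow>
      (\<forall>(\<gamma>'::real) (\<psi>::nat \<Rightarrow> real).
        (\<forall>q\<ge>1. \<psi> q > 0) \<longrightarrow>
        (\<exists>C>0. \<forall>q\<ge>3. \<psi> q \<le> C * (1 / (real q * log 2 (real q) * (log 2 (log 2 (real q)))\<^sup>2))) \<longrightarrow>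
        (\<Sum>\<^sub>\<infinity>q | q \<ge> 1 \<and> int_dist (real q * \<beta> - \<gamma>') \<in> {real q powr (- \<omega>)..<1}.
            ennreal (\<psi> q / int_dist (real q * \<beta> - \<gamma>'))) = \<infinity> \<longrightarrow>
        measure lebesgue (W \<psi> \<beta> \<gamma> \<gamma>') = 1))"
proof -
  obtain c R where dio: "diophantine_with c R \<gamma> \<beta>"
    using diophantine_pair_imp_diophantine_with[OF assms(3)] by blast
  define t where "t = 1 / (40 * R\<^sup>2)"
  have R: "R \<ge> 1" using dio by (simp add: diophantine_with_def)
  have t: "t > 0" "t \<le> 1/40"
    using R by (auto simp: t_def divide_le_eq one_le_power)
  show ?thesis
  \<comment> \<open>The threshold for \<omega> is \<open>t\<close>, which depends only on the
    Diophantine exponent \<open>R\<close>.\<close>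
  proof (intro exI[of _ t] conjI allI impI t(1))
    fix \<omega> \<gamma>' :: real and \<psi> :: "nat \<Rightarrow> real"
    assume \<omega>: "0 < \<omega> \<and> \<omega> < t" and \<psi>: "\<forall>q\<ge>1. \<psi> q > 0"
      and upper: "\<exists>C>0. \<forall>q\<ge>3. \<psi> q \<le> C * (1 / (real q * log 2 (real q) * (log 2 (log 2 (real q)))\<^sup>2))"
    define dist_q where "dist_q = (\<lambda>q::nat. int_dist (real q * \<beta> - \<gamma>'))"
    define \<delta> where "\<delta> = (\<lambda>q. \<psi> q / dist_q q)"
    define S\<^sub>0 where "S\<^sub>0 = {q::nat. q \<ge> 1 \<and> dist_q q \<in> {real q powr (- \<omega>)..<1}}"
    assume "(\<Sum>\<^sub>\<infinity>q | q \<ge> 1 \<and> int_dist (real q * \<beta> - \<gamma>') \<in> {real q powr (- \<omega>)..<1}.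
            ennreal (\<psi> q / int_dist (real q * \<beta> - \<gamma>'))) = \<infinity>"
    then have div: "(\<Sum>\<^sub>\<infinity>q\<in>S\<^sub>0. ennreal (\<delta> q)) = \<infinity>" by (simp add: S\<^sub>0_def \<delta>_def dist_q_def)
    obtain C\<^sub>0 where C0: "C\<^sub>0 > 0"
      "\<And>q. q \<ge> 3 \<Longrightarrow> \<psi> q \<le> C\<^sub>0 * (1 / (real q * log 2 (real q) * (log 2 (log 2 (real q)))\<^sup>2))"
      using upper by blast
    define C where "C = max 1 C\<^sub>0"
    have C: "C \<ge> 1" by (simp add: C_def)
    have w_pos: "dist_q q > 0" if "q \<in> S\<^sub>0" for q
      using that by (auto simp: S\<^sub>0_def intro: less_le_trans[of _ "real q powr (- \<omega>)"])
    have \<delta>_pos: "\<delta> q > 0" if "q \<in> S\<^sub>0" for q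
      using \<psi> w_pos[OF that] that by (auto simp: \<delta>_def S\<^sub>0_def)
    have \<delta>_le: "\<delta> q \<le> C / (real q * ln (real q) * dist_q q)" if "q \<in> S\<^sub>0" "q \<ge> 4" for q
    proof -
      have "\<psi> q \<le> C\<^sub>0 / (real q * ln (real q))"
        using that C0 by (intro le_of_log2_bound) auto
      also have "\<dots> \<le> C / (real q * ln (real q))" using that by (intro divide_right_mono) (auto simp: C_def)
      finally have "\<psi> q / dist_q q \<le> C / (real q * ln (real q)) / dist_q q"
        using w_pos[OF that(1)] by (intro divide_right_mono) auto
      then show ?thesis by (simp add: \<delta>_def)
    qed
    have w_ge: "real q powr (- t) \<le> dist_q q" if "q \<in> S\<^sub>0" for q
    proof -
      have "real q powr (- t) \<le> real q powr (- \<omega>)" using that \<omega> by (intro powr_mono) (auto simp: S\<^sub>0_def)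
      then show ?thesis using that by (auto simp: S\<^sub>0_def)
    qed
    obtain K U where KU: "\<forall>\<gamma>' \<delta> u V. U \<le> u \<longrightarrow> finite V \<longrightarrow>
      (\<forall>v\<in>V. large_index.partner t C \<gamma> \<beta> \<gamma>' \<delta> u v) \<longrightarrow> (\<Sum>v\<in>V. real (gcd u v)) \<le> K * real u"
      using sum_gcd_overlap_le[OF dio C, folded t_def] by (elim exE)
    obtain U' where U': "\<And>u::nat. u \<ge> U' \<Longrightarrow> 2 * C \<le> real u powr t \<and> 12 \<le> real u powr t \<and> 1 / c \<le> real u powr t
      \<and> ln (real u) \<le> real u powr t \<and> C * (ln (real u))\<^sup>2 < real u powr (t / 2) \<and> 3 \<le> ln (real u)"
      using eventually_large[OF t(1), of C c] unfolding eventually_sequentially by blast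
    \<comment> \<open>Indices with \<delta> below a summable sequence, and finitely many small ones,
      are discarded; this preserves divergence and yields the lower bound required of
      partners.\<close>
    define S where "S = {q\<in>S\<^sub>0. q \<ge> U \<and> q \<ge> U' \<and> q \<ge> 4 \<and> 1 / (real q * (ln (real q))\<^sup>2) \<le> \<delta> q}"
    have large: "large_index c R t C \<gamma> \<beta> u" if "u \<in> S" for u
      by unfold_locales (use dio C U'[of u] that in \<open>simp_all add: t_def S_def\<close>)
    have \<delta>_half: "\<delta> q \<le> 1/2" if "q \<in> S" for q
    proof -
      have q: "q \<in> S\<^sub>0" "q \<ge> U'" "q \<ge> 4" using that by (auto simp: S_def)
      have "\<delta> q \<le> C / (real q * ln (real q) * dist_q q)" using q by (intro \<delta>_le)
      also have "\<dots> \<le> C / (real q * 1 * real q powr (- t))"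
        using q C U'[of q] w_ge[of q] w_pos[of q]
        by (intro divide_left_mono mult_mono mult_pos_pos) auto
      also have "\<dots> = C * (real q powr t / real q)" using q by (simp add: powr_minus field_simps)
      also have "\<dots> \<le> real q powr t / 2 * (real q powr t / real q)"
        using U'[of q] q by (intro mult_right_mono) auto
      also have "\<dots> = real q powr (2 * t) / real q / 2" by (simp flip: powr_add)
      also have "\<dots> \<le> real q powr 1 / real q / 2"
        using q t by (intro divide_right_mono powr_mono) auto
      also have "\<dots> = 1/2" using q by simp
      finally show ?thesis .
    qed
    \<comment> \<open>The points missed by every approximation set from index \<open>m\<close> on;
      the covering result is applied to each tail separately, since infinitely many sets have to be
      hit.\<close>
    define N where "N = (\<lambda>m. {0..<1} - (\<Union>q\<in>S \<inter> {m..}. approx_set \<gamma> (\<delta> q) q))"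
    have null: "N m \<in> null_sets lborel" for m
    proof (rule null_setsI)
      show "N m \<in> sets lborel" unfolding N_def using open_approx_set by (auto intro!: sets.Diff borel_open)
      show "emeasure lborel (N m) = 0"
        unfolding N_def
      proof (rule approx_sets_cover_almost_all[where C = K])
        fix q assume "q \<in> S \<inter> {m..}"
        then show "q > 0 \<and> 0 < \<delta> q \<and> \<delta> q \<le> 1/2"
          using \<delta>_half[of q] \<delta>_pos[of q] by (auto simp: S_def S\<^sub>0_def)
      next
        fix u V
        assume u: "u \<in> S \<inter> {m..}" and V: "finite V" "V \<subseteq> S \<inter> {m..} - {u}"
          and le: "\<And>v. v \<in> V \<Longrightarrow> \<delta> u / real u \<le> \<delta> v / real v"
        let ?P = "\<lambda>v. int_dist ((real v - real u) / real (gcd u v) * \<gamma>) < 2 * real u * \<delta> v / real (gcd u v)"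
        have uS: "u \<in> S" using u by simp
        interpret large_index c R t C \<gamma> \<beta> \<gamma>' \<delta> u using large[OF uS] .
        have "(\<Sum>v\<in>V. if ?P v then real (gcd u v) else 0) = (\<Sum>v | v \<in> V \<and> ?P v. real (gcd u v))"
          using V by (simp add: sum.inter_filter)
        also have "\<dots> \<le> K * real u"
        proof (rule KU[rule_format])
          show "U \<le> u" using uS by (simp add: S_def)
          fix v assume "v \<in> {v. v \<in> V \<and> ?P v}"
          then have v: "v \<in> V" "?P v" "v \<in> S" "v \<in> S\<^sub>0" "v \<ge> 4" "v \<noteq> u" using V by (auto simp: S_def)
          \<comment> \<open>The lower bound for \<delta> at \<open>u\<close> passes to
            \<open>v\<close> through the ordering of the ratios.\<close>
          have "1 / ((real u)\<^sup>2 * (ln (real u))\<^sup>2) = 1 / (real u * (ln (real u))\<^sup>2) / real u"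
            by (simp add: power2_eq_square)
          also have "\<dots> \<le> \<delta> u / real u" using uS by (intro divide_right_mono) (auto simp: S_def)
          also have "\<dots> \<le> \<delta> v / real v" using le v by simp
          finally show "partner v"
            using v w_ge[OF v(4)] \<delta>_le[OF v(4,5)] by (simp add: partner_def dist_q_def w_def)
        qed (use V in auto)
        finally show "(\<Sum>v\<in>V. if ?P v then real (gcd u v) else 0) \<le> K * real u" .
      next
        fix B :: real
        show "\<exists>F. finite F \<and> F \<subseteq> S \<inter> {m..} \<and> B \<le> (\<Sum>q\<in>F. \<delta> q)"
        proof (rule ccontr)
          assume contra: "\<not> ?thesis"
          define m' where "m' = max m (max U (max U' 4))"
          define h where "h = (\<lambda>q. 1 / (real q * (ln (real q))\<^sup>2))"
          have h0: "h q \<ge> 0" for q by (simp add: h_def)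
          \<comment> \<open>If finite sums over the tail of \<open>S\<close> stayed below
            \<open>B\<close>, then all finite sums over \<open>S\<^sub>0\<close> would be at most
            \<open>T\<close>: the first part covers small indices, the second those with \<delta> <
            h, the third those in \<open>S\<close>.\<close>
          define T where "T = (\<Sum>q\<in>S\<^sub>0 \<inter> {..<m'}. \<delta> q) + suminf h + B"
          have "sum \<delta> F \<le> T" if F: "finite F" "F \<subseteq> S\<^sub>0" for F
          proof -
            define F\<^sub>1 where "F\<^sub>1 = F \<inter> {..<m'}"
            define F\<^sub>2 where "F\<^sub>2 = F \<inter> {m'..} \<inter> {q. \<delta> q < h q}"
            define F\<^sub>3 where "F\<^sub>3 = F \<inter> {m'..} \<inter> {q. \<not> \<delta> q < h q}"
            have "sum \<delta> F = sum \<delta> F\<^sub>1 + (sum \<delta> F\<^sub>2 + sum \<delta> F\<^sub>3)"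
            proof -
              have "F = F\<^sub>1 \<union> (F\<^sub>2 \<union> F\<^sub>3)" by (auto simp: F\<^sub>1_def F\<^sub>2_def F\<^sub>3_def)
              moreover have "sum \<delta> (F\<^sub>1 \<union> (F\<^sub>2 \<union> F\<^sub>3)) = sum \<delta> F\<^sub>1 + sum \<delta> (F\<^sub>2 \<union> F\<^sub>3)"
                by (rule sum.union_disjoint) (use F in \<open>auto simp: F\<^sub>1_def F\<^sub>2_def F\<^sub>3_def\<close>)
              moreover have "sum \<delta> (F\<^sub>2 \<union> F\<^sub>3) = sum \<delta> F\<^sub>2 + sum \<delta> F\<^sub>3"
                by (rule sum.union_disjoint) (use F in \<open>auto simp: F\<^sub>2_def F\<^sub>3_def\<close>)
              ultimately show ?thesis by metis
            qed
            moreover have "sum \<delta> F\<^sub>1 \<le> (\<Sum>q\<in>S\<^sub>0 \<inter> {..<m'}. \<delta> q)"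
              using F \<delta>_pos by (intro sum_mono2) (auto simp: F\<^sub>1_def intro: less_imp_le)
            moreover have "sum \<delta> F\<^sub>2 \<le> suminf h"
            proof -
              have "sum \<delta> F\<^sub>2 \<le> sum h F\<^sub>2" by (intro sum_mono) (auto simp: F\<^sub>2_def)
              also have "\<dots> \<le> suminf h"
                using F h0 summable_inverse_mult_ln_square by (intro sum_le_suminf) (auto simp: h_def F\<^sub>2_def)
              finally show ?thesis .
            qed
            moreover have "sum \<delta> F\<^sub>3 \<le> B"
            proof -
              have "finite F\<^sub>3" "F\<^sub>3 \<subseteq> S \<inter> {m..}"
                using F by (auto simp: F\<^sub>3_def S_def m'_def h_def)
              then have "\<not> B \<le> sum \<delta> F\<^sub>3" using contra by blast
              then show ?thesis by simp
            qed
            ultimately show ?thesis unfolding T_def by linarith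
          qed
          then have "(\<Sum>q\<in>F. ennreal (\<delta> q)) \<le> ennreal T" if "finite F" "F \<subseteq> S\<^sub>0" for F
            using that \<delta>_pos by (subst sum_ennreal) (auto intro: ennreal_leI less_imp_le)
          then have "(SUP F\<in>{F. finite F \<and> F \<subseteq> S\<^sub>0}. \<Sum>q\<in>F. ennreal (\<delta> q)) \<le> ennreal T"
            by (intro SUP_least) blast
          moreover have "(\<Sum>\<^sub>\<infinity>q\<in>S\<^sub>0. ennreal (\<delta> q)) = (SUP F\<in>{F. finite F \<and> F \<subseteq> S\<^sub>0}. \<Sum>q\<in>F. ennreal (\<delta> q))"
            by (rule nonneg_infsum_complete) simp
          ultimately have "(\<Sum>\<^sub>\<infinity>q\<in>S\<^sub>0. ennreal (\<delta> q)) \<le> ennreal T" by simp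
          then show False using div by (simp add: top_unique)
        qed
      qed
    qed
    show "measure lebesgue (W \<psi> \<beta> \<gamma> \<gamma>') = 1"
    proof (rule measure_eq_one_of_almost_all)
      show "W \<psi> \<beta> \<gamma> \<gamma>' \<subseteq> {0..1}" by (auto simp: W_def)
      show "(\<Union>m. N m) \<in> null_sets lborel" using null by (intro null_sets_UN) auto
      show "{0..<1} - (\<Union>m. N m) \<subseteq> W \<psi> \<beta> \<gamma> \<gamma>'"
      proof
        fix x assume x: "x \<in> {0..<1} - (\<Union>m. N m)"
        let ?Q = "{q::nat. q \<ge> 1 \<and> int_dist (of_nat q * x - \<gamma>) * int_dist (of_nat q * \<beta> - \<gamma>') < \<psi> q}"
        \<comment> \<open>Since \<open>x\<close> avoids every \<open>N m\<close>, it lies in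
          approximation sets of arbitrarily large index.\<close>
        have "\<exists>q\<ge>m. q \<in> ?Q" for m
        proof -
          obtain q where q: "q \<in> S" "q \<ge> m" "x \<in> approx_set \<gamma> (\<delta> q) q" using x by (auto simp: N_def)
          have q0: "q \<in> S\<^sub>0" "q \<ge> 1" using q by (auto simp: S_def)
          have "int_dist (real q * x - \<gamma>) < \<psi> q / dist_q q" using q(3) by (simp add: approx_set_def \<delta>_def)
          then have "int_dist (real q * x - \<gamma>) * dist_q q < \<psi> q" using w_pos[OF q0(1)] by (simp add: pos_less_divide_eq)
          then show ?thesis using q q0 by (auto simp: dist_q_def)
        qed
        then have "infinite ?Q" by (simp add: infinite_nat_iff_unbounded_le)
        then show "x \<in> W \<psi> \<beta> \<gamma> \<gamma>'" using x by (auto simp: W_def)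
      qed
    qed
  qed
qed

end
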